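(* Let $G$ be a nonempty finite simple graph without isolated vertices, let $m(G)$ denote its matching number (the maximum cardinality of a matching of $G$), and let $n$ be an integer with $2\leq n\leq m(G)$. Then the squarefree power $I(G)^{[n]}$ is Scarf if and only if one of the following holds: (1) $G$ has a perfect matching of size $n$. (2) The vertex set of $G$ can be labelled as $V(G)=\{x_1,\dots,x_{2n},y_1,\dots,y_\ell\}$ (distinct vertices) for some $\ell\geq 1$ such that $\{x_1x_2,\,x_3x_4,\,\dots,\,x_{2n-3}x_{2n-2},\,x_{2n-1}x_{2n}\}$ is a matching of $G$, and $x_{2n},y_1,\dots,y_\ell$ are leaves of $G$ with the common joint $x_{2n-1}$.
   Context: Let $\Bbbk$ be a field and $S=\Bbbk[V(G)]$ the polynomial ring whose variables are the vertices of $G$. The edge ideal is $I(G)=(xy : \{x,y\}\in E(G))\subseteq S$; an edge $\{x,y\}$ is also written $xy$. The $n$-th squarefree power $I(G)^{[n]}$ is the ideal generated by the squarefree monomials of $I(G)^n$; equivalently it is generated by the products of the edges of the matchings of size $n$ of $G$. A matching is a set of pairwise disjoint edges; a perfect matching is a matching covering all vertices. A leaf is a vertex with exactly one neighbour; that neighbour is its joint. Scarf ideals: for a monomial ideal $I$ let $\operatorname{Mingens}(I)$ be its set of minimal monomial generators. The Taylor resolution of $S/I$ has free basis $e_\sigma$, $\sigma\subseteq\operatorname{Mingens}(I)$, with $e_\sigma$ in homological degree $|\sigma|$ and $\partial(e_\sigma)=\sum_{j=1}^t(-1)^{j+1}\frac{\operatorname{lcm}(\sigma)}{\operatorname{lcm}(\sigma\setminus\{m_{i_j}\})}e_{\sigma\setminus\{m_{i_j}\}}$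 for $\sigma=\{m_{i_1},\dots,m_{i_t}\}$. The Scarf complex of $I$ is the simplicial complex of all $\sigma\subseteq\operatorname{Mingens}(I)$ such that $\operatorname{lcm}(\sigma)\neq\operatorname{lcm}(\tau)$ for every $\tau\subseteq\operatorname{Mingens}(I)$ with $\tau\neq\sigma$. It induces a subcomplex of the Taylor resolution (spanned by the $e_\sigma$ with $\sigma$ in the Scarf complex). $I$ is called Scarf if this subcomplex is a minimal free resolution of $S/I$ (equivalently, a free resolution of $S/I$). *)

theory Defs
  imports
    "HOL-Library.Poly_Mapping"
    "HOL-Algebra.QuotRing"
    "HOL-Algebra.Ideal_Product"
begin

section \<open>Graphs\<close>

definition simple_graph :: "'a set \<Rightarrow> 'a set set \<Rightarrow> bool" where
  "simple_graph V E \<longleftrightarrow> finite V \<and> (\<forall>e\<in>E. e \<subseteq> V \<and> card e = 2)"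

definition nbrs :: "'a set set \<Rightarrow> 'a \<Rightarrow> 'a set" where
  "nbrs E v = {w. {v, w} \<in> E}"

definition isolated :: "'a set set \<Rightarrow> 'a \<Rightarrow> bool" where
  "isolated E v \<longleftrightarrow> nbrs E v = {}"

definition leaf :: "'a set \<Rightarrow> 'a set set \<Rightarrow> 'a \<Rightarrow> bool" where
  "leaf V E v \<longleftrightarrow> v \<in> V \<and> card (nbrs E v) = 1"

definition joint_of :: "'a set set \<Rightarrow> 'a \<Rightarrow> 'a \<Rightarrow> bool" where
  "joint_of E v w \<longleftrightarrow> w \<in> nbrs E v"

definition matching :: "'a set set \<Rightarrow> 'a set set \<Rightarrow> bool" where
  "matching E M \<longleftrightarrow> M \<subseteq> E \<and> pairwise disjnt M"

definition matching_number :: "'a set set \<Rightarrow> nat" where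
  "matching_number E = Max (card ` {M. matching E M})"

definition perfect_matching :: "'a set \<Rightarrow> 'a set set \<Rightarrow> 'a set set \<Rightarrow> bool" where
  "perfect_matching V E M \<longleftrightarrow> matching E M \<and> \<Union>M = V"


section \<open>Monomials and polynomial rings\<close>

text \<open>A monomial is its exponent vector, so products of monomials are sums of exponent vectors.\<close>

type_synonym 'a mono = "'a \<Rightarrow>\<^sub>0 nat"
type_synonym ('a, 'k) mpoly = "'a mono \<Rightarrow>\<^sub>0 'k"

abbreviation monom :: "'a mono \<Rightarrow> ('a, 'k::zero_neq_one) mpoly" where
  "monom m \<equiv> Poly_Mapping.single m 1"

abbreviation var :: "'a \<Rightarrow> ('a, 'k::zero_neq_one) mpoly" where
  "var v \<equiv> monom (Poly_Mapping.single v 1)"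

text \<open>The polynomial ring with variable set \<open>V\<close>, inside the polynomials over all of \<open>'a\<close>.\<close>

definition poly_ring :: "'a set \<Rightarrow> ('a, 'k::comm_ring_1) mpoly ring" where
  "poly_ring V = \<lparr>carrier = {p. \<forall>m\<in>Poly_Mapping.keys p. Poly_Mapping.keys m \<subseteq> V},
     mult = (*), one = 1, zero = 0, add = (+)\<rparr>"

lemma cring_poly_ring: "cring (poly_ring V :: ('a, 'k::comm_ring_1) mpoly ring)"
proof (rule cringI)
  show "abelian_group (poly_ring V :: ('a, 'k) mpoly ring)"
  proof (rule abelian_groupI)
    fix p q :: "('a, 'k) mpoly"
    assume "p \<in> carrier (poly_ring V)" "q \<in> carrier (poly_ring V)"
    then show "p \<oplus>\<^bsub>poly_ring V\<^esub> q \<in> carrier (poly_ring V)"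
      using Poly_Mapping.keys_add[of p q] unfolding poly_ring_def by (simp, blast)
  next
    fix p :: "('a, 'k) mpoly"
    assume "p \<in> carrier (poly_ring V)"
    then show "\<exists>q\<in>carrier (poly_ring V). q \<oplus>\<^bsub>poly_ring V\<^esub> p = \<zero>\<^bsub>poly_ring V\<^esub>"
      by (intro bexI[of _ "- p"]) (simp_all add: poly_ring_def)
  qed (simp_all add: poly_ring_def ac_simps)
next
  show "comm_monoid (poly_ring V :: ('a, 'k) mpoly ring)"
  proof (rule comm_monoidI)
    fix p q :: "('a, 'k) mpoly"
    assume pq: "p \<in> carrier (poly_ring V)" "q \<in> carrier (poly_ring V)"
    have "Poly_Mapping.keys m \<subseteq> V" if "m \<in> Poly_Mapping.keys (p * q)" for m
    proof -
      obtain a b where "m = a + b" "a \<in> Poly_Mapping.keys p" "b \<in> Poly_Mapping.keys q"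
        using Poly_Mapping.keys_mult[of p q] \<open>m \<in> Poly_Mapping.keys (p * q)\<close> by blast
      then show ?thesis
        using Poly_Mapping.keys_add[of a b] pq unfolding poly_ring_def by (simp, blast)
    qed
    then show "p \<otimes>\<^bsub>poly_ring V\<^esub> q \<in> carrier (poly_ring V)"
      by (simp add: poly_ring_def)
  qed (simp_all add: poly_ring_def ac_simps)
qed (simp add: poly_ring_def algebra_simps)

definition mono_dvd :: "'a mono \<Rightarrow> 'a mono \<Rightarrow> bool" where
  "mono_dvd m m' \<longleftrightarrow> (\<forall>v. Poly_Mapping.lookup m v \<le> Poly_Mapping.lookup m' v)"

definition squarefree_mono :: "'a mono \<Rightarrow> bool" where
  "squarefree_mono m \<longleftrightarrow> (\<forall>v. Poly_Mapping.lookup m v \<le> 1)"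

text \<open>Least common multiple of a finite set of monomials; the one of the empty set is the
  monomial \<open>1\<close>, i.e. the exponent vector \<open>0\<close>.\<close>

definition mono_lcm :: "'a mono set \<Rightarrow> 'a mono" where
  "mono_lcm \<sigma> = Poly_Mapping.Abs_poly_mapping
     (\<lambda>v. Max (insert 0 ((\<lambda>m. Poly_Mapping.lookup m v) ` \<sigma>)))"

lemma lookup_mono_lcm:
  assumes "finite \<sigma>"
  shows "Poly_Mapping.lookup (mono_lcm \<sigma>) v = Max (insert 0 ((\<lambda>m. Poly_Mapping.lookup m v) ` \<sigma>))"
proof -
  have "{v. Max (insert 0 ((\<lambda>m. Poly_Mapping.lookup m v) ` \<sigma>)) \<noteq> 0}
      \<subseteq> (\<Union>m\<in>\<sigma>. Poly_Mapping.keys m)"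
  proof
    fix v assume "v \<in> {v. Max (insert 0 ((\<lambda>m. Poly_Mapping.lookup m v) ` \<sigma>)) \<noteq> 0}"
    moreover have "Max (insert 0 ((\<lambda>m. Poly_Mapping.lookup m v) ` \<sigma>))
        \<in> insert 0 ((\<lambda>m. Poly_Mapping.lookup m v) ` \<sigma>)"
      using assms by (intro Max_in) auto
    ultimately show "v \<in> (\<Union>m\<in>\<sigma>. Poly_Mapping.keys m)"
      by (auto simp: in_keys_iff)
  qed
  then have "finite {v. Max (insert 0 ((\<lambda>m. Poly_Mapping.lookup m v) ` \<sigma>)) \<noteq> 0}"
    by (rule finite_subset) (use assms in auto)
  then show ?thesis
    by (simp add: mono_lcm_def)
qed

definition mingens :: "('a, 'k::zero_neq_one) mpoly set \<Rightarrow> 'a mono set" where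
  "mingens I = {m. monom m \<in> I \<and> (\<forall>m'. monom m' \<in> I \<and> mono_dvd m' m \<longrightarrow> m' = m)}"


section \<open>Edge ideals and squarefree powers\<close>

definition edge_ideal :: "'a set \<Rightarrow> 'a set set \<Rightarrow> ('a, 'k::comm_ring_1) mpoly set" where
  "edge_ideal V E = Idl\<^bsub>poly_ring V\<^esub> {var x * var y | x y. {x, y} \<in> E}"

text \<open>In the monoid \<^const>\<open>ideals_set\<close> multiplication is the product of ideals and the unit is
  the whole ring, so the power below is the ordinary power of an ideal.\<close>

definition squarefree_power ::
    "'a set \<Rightarrow> ('a, 'k::comm_ring_1) mpoly set \<Rightarrow> nat \<Rightarrow> ('a, 'k) mpoly set" where
  "squarefree_power V I n = Idl\<^bsub>poly_ring V\<^esub>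
     {monom m | m. squarefree_mono m \<and> monom m \<in> I [^]\<^bsub>ideals_set (poly_ring V)\<^esub> n}"


section \<open>The Taylor differential and Scarf ideals\<close>

text \<open>The signs of the Taylor differential require the elements of \<open>\<sigma>\<close> to be listed in some
  order. We fix an arbitrary total order of all monomials; another choice only changes the
  signs of the basis elements.\<close>

definition mono_order :: "'a mono rel" where
  "mono_order = (SOME r. linear_order r)"

lemma linear_order_mono_order: "linear_order (mono_order :: 'a mono rel)"
proof -
  obtain r :: "'a mono rel" where "well_order_on UNIV r"
    using well_order_on by blast
  then have "linear_order r"
    by (simp add: well_order_on_def)
  then show ?thesis
    unfolding mono_order_def by (rule someI)
qed

text \<open>Coefficient of \<open>e\<^bsub>\<sigma> - {m}\<^esub>\<close> in the differential of \<open>e\<^bsub>\<sigma>\<^esub>\<close>. If \<open>m\<close> is the \<open>j\<close>-th element of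
  \<open>\<sigma>\<close>, counted from 1, it has \<open>j - 1\<close> predecessors, and \<open>(-1)^(j-1) = (-1)^(j+1)\<close>. The quotient
  of the two least common multiples is a difference of exponent vectors.\<close>

definition taylor_coeff :: "'a mono set \<Rightarrow> 'a mono \<Rightarrow> ('a, 'k::comm_ring_1) mpoly" where
  "taylor_coeff \<sigma> m =
     (- 1) ^ card {m'\<in>\<sigma>. m' \<noteq> m \<and> (m', m) \<in> mono_order} * monom (mono_lcm \<sigma> - mono_lcm (\<sigma> - {m}))"

text \<open>An element of the free module with basis \<open>e\<^bsub>\<sigma>\<^esub>\<close> is the finitely supported function mapping
  \<open>\<sigma>\<close> to the coefficient of \<open>e\<^bsub>\<sigma>\<^esub>\<close>.\<close>

definition taylor_diff ::
    "('a mono set \<Rightarrow>\<^sub>0 ('a, 'k::comm_ring_1) mpoly) \<Rightarrow> ('a mono set \<Rightarrow>\<^sub>0 ('a, 'k) mpoly)" where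
  "taylor_diff f = (\<Sum>\<sigma>\<in>Poly_Mapping.keys f. \<Sum>m\<in>\<sigma>.
     Poly_Mapping.single (\<sigma> - {m}) (Poly_Mapping.lookup f \<sigma> * taylor_coeff \<sigma> m))"

definition free_module ::
    "'a set \<Rightarrow> 'b set \<Rightarrow> ('b \<Rightarrow>\<^sub>0 ('a, 'k::comm_ring_1) mpoly) set" where
  "free_module V B = {f. Poly_Mapping.keys f \<subseteq> B \<and>
     (\<forall>b. Poly_Mapping.lookup f b \<in> carrier (poly_ring V))}"

definition scarf_complex :: "('a, 'k::zero_neq_one) mpoly set \<Rightarrow> 'a mono set set" where
  "scarf_complex I = {\<sigma>. \<sigma> \<subseteq> mingens I \<and>
     (\<forall>\<tau>. \<tau> \<subseteq> mingens I \<and> \<tau> \<noteq> \<sigma> \<longrightarrow> mono_lcm \<sigma> \<noteq> mono_lcm \<tau>)}"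

definition scarf_module ::
    "'a set \<Rightarrow> ('a, 'k::comm_ring_1) mpoly set \<Rightarrow> nat \<Rightarrow> ('a mono set \<Rightarrow>\<^sub>0 ('a, 'k) mpoly) set" where
  "scarf_module V I i = free_module V {\<sigma> \<in> scarf_complex I. card \<sigma> = i}"

text \<open>The augmentation from homological degree \<open>0\<close> to \<open>S/I\<close>, sending \<open>e\<^bsub>{}\<^esub>\<close> to the class of \<open>1\<close>.\<close>

definition augmentation ::
    "'a set \<Rightarrow> ('a, 'k::comm_ring_1) mpoly set \<Rightarrow> ('a mono set \<Rightarrow>\<^sub>0 ('a, 'k) mpoly) \<Rightarrow> ('a, 'k) mpoly set" where
  "augmentation V I f = I +>\<^bsub>poly_ring V\<^esub> Poly_Mapping.lookup f {}"

definition scarf_is_resolution :: "'a set \<Rightarrow> ('a, 'k::comm_ring_1) mpoly set \<Rightarrow> bool" where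
  "scarf_is_resolution V I \<longleftrightarrow>
     augmentation V I ` scarf_module V I 0 = carrier (poly_ring V Quot I) \<and>
     {f \<in> scarf_module V I 0. augmentation V I f = \<zero>\<^bsub>poly_ring V Quot I\<^esub>}
       = taylor_diff ` scarf_module V I 1 \<and>
     (\<forall>i\<ge>1. {f \<in> scarf_module V I i. taylor_diff f = 0} = taylor_diff ` scarf_module V I (Suc i))"

definition scarf_is_minimal :: "'a set \<Rightarrow> ('a, 'k::comm_ring_1) mpoly set \<Rightarrow> bool" where
  "scarf_is_minimal V I \<longleftrightarrow>
     (\<forall>i. \<forall>f \<in> scarf_module V I (Suc i). \<forall>\<sigma>.
        Poly_Mapping.lookup (taylor_diff f) \<sigma> \<in> Idl\<^bsub>poly_ring V\<^esub> (var ` V))"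

definition scarf_ideal :: "'a set \<Rightarrow> ('a, 'k::comm_ring_1) mpoly set \<Rightarrow> bool" where
  "scarf_ideal V I \<longleftrightarrow> scarf_is_resolution V I \<and> scarf_is_minimal V I"

end

(*
  The minimal generators of the squarefree power are the vertex sets of the n-matchings.

  If these generators have pairwise distinct least common multiples of subsets, then the Scarf
  complex is the whole Taylor complex, which is exact: in each multidegree it is the chain complex
  of a full simplex. This happens in (1), with one generator, and in (2), where every generator
  consists of all vertices that are not one of the leaves x_2n, y_1, ..., y_l, and one of these.

  Conversely, exactness in each multidegree makes the graph of Scarf edges inside every vertex set
  connected, where two generators form a Scarf edge if no third one lies in their union; in
  particular a set of 2n + 1 vertices contains at most two generators. On the vertices of a matching
  of size n + 1 >= 3 this is contradictory, so n is the matching number. A vertex v missed by a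
  maximum matching is then a leaf, because two neighbours of v would give three generators in 2n + 1
  vertices, and so is the matching partner of its joint. Finally, two different joints would give
  four generators that form an empty square in the Scarf complex, contradicting exactness in
  homological degree 2.
*)
theory Submission
  imports Defs
begin

text \<open>No homology groups appear. Failure of exactness is shown by one scalar functional on the
  coefficients in a single multidegree \<open>W\<close> that kills every boundary but not a chosen
  cycle: in homological degree 1 the sum over a union of components, in degree 2 the coefficient of
  one edge of the square. Exactness in turn comes from an explicit contracting homotopy. The
  obstacle there is that in general no generator divides every multidegree in question, so the apex
  varies with the multidegree and the homotopy is defined term by term. Inside the vertices of an
  (n+1)-matching, a matched set of size 2n is the complement of a pair. A Scarf edge between
  complements of disjoint pairs would have the whole vertex set as union, and excluding it takes a
  matching edge different from both pairs, hence n + 1 >= 3. Two disjoint edges show the difference: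
  for n = 1 their edge ideal is Scarf, although the graph has neither shape.\<close>

abbreviation keys :: "('b \<Rightarrow>\<^sub>0 'c::zero) \<Rightarrow> 'b set" where
  "keys \<equiv> Poly_Mapping.keys"

abbreviation lookup :: "('b \<Rightarrow>\<^sub>0 'c::zero) \<Rightarrow> 'b \<Rightarrow> 'c" where
  "lookup \<equiv> Poly_Mapping.lookup"

section \<open>Monomials\<close>

lemma mono_dvd_refl [simp]: "mono_dvd m m"
  by (simp add: mono_dvd_def)

lemma mono_dvd_trans: "mono_dvd a b \<Longrightarrow> mono_dvd b c \<Longrightarrow> mono_dvd a c"
  unfolding mono_dvd_def by (meson le_trans)

lemma mono_dvd_antisym: "mono_dvd a b \<Longrightarrow> mono_dvd b a \<Longrightarrow> a = b"
  unfolding mono_dvd_def by (intro poly_mapping_eqI) (meson le_antisym)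

lemma mono_dvd_addI [simp]: "mono_dvd a (b + a)" "mono_dvd a (a + b)"
  by (simp_all add: mono_dvd_def lookup_add)

lemma mono_dvd_imp_keys_subset: "mono_dvd a b \<Longrightarrow> keys a \<subseteq> keys b"
  unfolding mono_dvd_def by (auto simp: in_keys_iff) (metis less_le_trans)

lemma mono_diff_add_cancel: "mono_dvd a b \<Longrightarrow> (b - a) + a = b"
  unfolding mono_dvd_def by (intro poly_mapping_eqI) (simp add: lookup_add lookup_minus)

lemma keys_add_mono: "keys (a + b :: 'a mono) = keys a \<union> keys b"
  by (auto simp: in_keys_iff lookup_add)

lemma keys_diff_mono_subset: "keys (a - b :: 'a mono) \<subseteq> keys a"
  by (auto simp: in_keys_iff lookup_minus)

lemma mono_lcm_dvd_iff:
  assumes "finite \<sigma>"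
  shows "mono_dvd (mono_lcm \<sigma>) w \<longleftrightarrow> (\<forall>m\<in>\<sigma>. mono_dvd m w)"
  using assms by (auto simp: mono_dvd_def lookup_mono_lcm)

lemma mono_lcm_empty [simp]: "mono_lcm {} = 0"
  by (rule poly_mapping_eqI) (simp add: lookup_mono_lcm)

lemma mono_lcm_singleton [simp]: "mono_lcm {m} = m"
  by (rule poly_mapping_eqI) (simp add: lookup_mono_lcm)

lemma mono_lcm_mono:
  assumes "finite \<sigma>" "\<tau> \<subseteq> \<sigma>"
  shows "mono_dvd (mono_lcm \<tau>) (mono_lcm \<sigma>)"
  using assms mono_lcm_dvd_iff[OF assms(1), of "mono_lcm \<sigma>"]
  by (subst mono_lcm_dvd_iff) (auto intro: finite_subset)

lemma mono_dvd_lcm: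
  assumes "finite \<sigma>" "m \<in> \<sigma>"
  shows "mono_dvd m (mono_lcm \<sigma>)"
  using mono_lcm_dvd_iff[OF assms(1), of "mono_lcm \<sigma>"] assms(2) by simp

lemma keys_mono_lcm_subset:
  assumes "finite \<sigma>" "\<And>m. m \<in> \<sigma> \<Longrightarrow> keys m \<subseteq> V"
  shows "keys (mono_lcm \<sigma>) \<subseteq> V"
proof
  fix v assume v: "v \<in> keys (mono_lcm \<sigma>)"
  show "v \<in> V"
  proof (rule ccontr)
    assume "v \<notin> V"
    then have "\<forall>m\<in>\<sigma>. lookup m v = 0" using assms(2) by (meson in_keys_iff subsetD)
    then have "insert 0 ((\<lambda>m. lookup m v) ` \<sigma>) = {0}" by auto
    then have "lookup (mono_lcm \<sigma>) v = 0"
      by (simp only: lookup_mono_lcm assms(1) Max_singleton)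
    then show False using v by (simp add: in_keys_iff)
  qed
qed

section \<open>Squarefree monomials as vertex sets\<close>

definition set_mono :: "'a set \<Rightarrow> 'a mono" where
  "set_mono S = (\<Sum>v\<in>S. Poly_Mapping.single v 1)"

lemma lookup_set_mono: "finite S \<Longrightarrow> lookup (set_mono S) v = (if v \<in> S then 1 else 0)"
  by (simp add: set_mono_def lookup_sum lookup_single when_def)

lemma keys_set_mono: "finite S \<Longrightarrow> keys (set_mono S) = S"
  by (auto simp: in_keys_iff lookup_set_mono split: if_splits)

lemma set_mono_inj: "finite S \<Longrightarrow> finite T \<Longrightarrow> set_mono S = set_mono T \<longleftrightarrow> S = T"
  by (metis keys_set_mono)

lemma set_mono_dvd_iff: "finite S \<Longrightarrow> mono_dvd (set_mono S) u \<longleftrightarrow> S \<subseteq> keys u"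
  by (auto simp: mono_dvd_def lookup_set_mono in_keys_iff Suc_le_eq)

lemma squarefree_set_mono: "finite S \<Longrightarrow> squarefree_mono (set_mono S)"
  by (simp add: squarefree_mono_def lookup_set_mono)

lemma squarefree_mono_add:
  assumes "squarefree_mono (a + b)"
  shows "squarefree_mono a" "squarefree_mono b" "keys a \<inter> keys b = {}"
proof -
  have *: "lookup a v + lookup b v \<le> 1" for v
    using assms by (simp add: squarefree_mono_def lookup_add)
  show "squarefree_mono a" "squarefree_mono b"
    unfolding squarefree_mono_def using * by (meson add_leE)+
  show "keys a \<inter> keys b = {}"
  proof (rule ccontr)
    assume "keys a \<inter> keys b \<noteq> {}"
    then obtain v where "lookup a v \<noteq> 0" "lookup b v \<noteq> 0" by (auto simp: in_keys_iff)
    then show False using *[of v] by simp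
  qed
qed

lemma set_mono_union_disjoint:
  assumes "finite S" "finite T" "S \<inter> T = {}"
  shows "set_mono (S \<union> T) = set_mono S + set_mono T"
  using assms by (simp add: set_mono_def sum.union_disjoint)

lemma mono_lcm_set_mono:
  assumes "finite F" "\<And>S. S \<in> F \<Longrightarrow> finite S"
  shows "mono_lcm (set_mono ` F) = set_mono (\<Union>F)"
proof (rule mono_dvd_antisym)
  show "mono_dvd (mono_lcm (set_mono ` F)) (set_mono (\<Union>F))"
    using assms by (auto simp: mono_lcm_dvd_iff set_mono_dvd_iff keys_set_mono)
  have "S \<subseteq> keys (mono_lcm (set_mono ` F))" if "S \<in> F" for S
    using mono_dvd_imp_keys_subset[OF mono_dvd_lcm, of "set_mono ` F" "set_mono S"] assms that
    by (auto simp: keys_set_mono)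
  then show "mono_dvd (set_mono (\<Union>F)) (mono_lcm (set_mono ` F))"
    using assms by (auto simp: set_mono_dvd_iff)
qed


section \<open>Polynomials and monomial ideals\<close>

lemma poly_mapping_sum_single:
  fixes f :: "'b \<Rightarrow>\<^sub>0 'c::comm_monoid_add"
  shows "f = (\<Sum>k\<in>keys f. Poly_Mapping.single k (lookup f k))"
  by (rule poly_mapping_eqI) (simp add: lookup_sum lookup_single when_def in_keys_iff)

text \<open>Subtraction of exponents is truncated at 0, so \<open>u - t\<close> is the true quotient
  only if \<open>t\<close> divides \<open>u\<close>; otherwise no term of \<open>p\<close> can reach
  \<open>u\<close>.\<close>

lemma lookup_times_single:
  fixes p :: "('a, 'k::comm_ring_1) mpoly"
  shows "lookup (p * Poly_Mapping.single t c) u = (if mono_dvd t u then lookup p (u - t) * c else 0)"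
proof -
  have "p * Poly_Mapping.single t c = (\<Sum>k\<in>keys p. Poly_Mapping.single (k + t) (lookup p k * c))"
    by (subst poly_mapping_sum_single[of p]) (simp add: sum_distrib_right mult_single)
  then have l: "lookup (p * Poly_Mapping.single t c) u = (\<Sum>k\<in>keys p. if k + t = u then lookup p k * c else 0)"
    by (simp add: lookup_sum lookup_single when_def)
  show ?thesis
  proof (cases "mono_dvd t u")
    case True
    have "k + t = u \<longleftrightarrow> k = u - t" for k
      using mono_diff_add_cancel[OF True] by auto
    then show ?thesis using True
      by (simp add: l in_keys_iff)
  next
    case False
    have "k + t \<noteq> u" for k
      using False by auto
    then show ?thesis using False by (simp add: l)
  qed
qed

lemma poly_ring_simps [simp]:
  "x \<otimes>\<^bsub>poly_ring V\<^esub> y = x * y" "x \<oplus>\<^bsub>poly_ring V\<^esub> y = x + y"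
  "\<one>\<^bsub>poly_ring V\<^esub> = 1" "\<zero>\<^bsub>poly_ring V\<^esub> = 0"
  by (simp_all add: poly_ring_def)

lemma in_carrier_poly_ring: "p \<in> carrier (poly_ring V) \<longleftrightarrow> (\<forall>m\<in>keys p. keys m \<subseteq> V)"
  by (simp add: poly_ring_def)

lemma a_inv_poly_ring:
  assumes "x \<in> carrier (poly_ring V :: ('a, 'k::comm_ring_1) mpoly ring)"
  shows "\<ominus>\<^bsub>poly_ring V\<^esub> x = - x"
proof -
  interpret cring "poly_ring V :: ('a, 'k) mpoly ring" by (rule cring_poly_ring)
  have "- x \<in> carrier (poly_ring V)" using assms by (simp add: in_carrier_poly_ring)
  then show ?thesis using assms minus_equality[of "- x" x] by simp
qed

text \<open>A monomial ideal described by supports: membership is decided for each term separately.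
  The edge ideal, its squarefree powers and the ideal of the variables are all brought into this
  form, where cancellation between terms cannot interfere.\<close>

definition mono_ideal :: "'a set \<Rightarrow> 'a mono set \<Rightarrow> ('a, 'k::comm_ring_1) mpoly set" where
  "mono_ideal V G = {p \<in> carrier (poly_ring V). \<forall>u\<in>keys p. \<exists>a\<in>G. mono_dvd a u}"

lemma ideal_by_keys:
  assumes up: "\<And>a b. P a \<Longrightarrow> P (a + b)"
  shows "ideal {p \<in> carrier (poly_ring V). \<forall>u\<in>keys p. P u} (poly_ring V :: ('a, 'k::comm_ring_1) mpoly ring)"
    (is "ideal ?I ?R")
proof -
  interpret cring ?R by (rule cring_poly_ring)
  have mult: "x * a \<in> ?I" if "a \<in> ?I" "x \<in> carrier ?R" for a x
  proof -
    have "x * a \<in> carrier ?R" using m_closed[of x a] that by simp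
    moreover have "P u" if u: "u \<in> keys (x * a)" for u
    proof -
      obtain b c where "u = b + c" "b \<in> keys x" "c \<in> keys a"
        using keys_mult[of x a] u by blast
      then show ?thesis using up[of c b] \<open>a \<in> ?I\<close> by (simp add: add.commute)
    qed
    ultimately show ?thesis by simp
  qed
  show ?thesis
  proof (rule idealI)
    show "ring ?R" by (rule ring_axioms)
    show "subgroup ?I (add_monoid ?R)"
    proof (rule add.subgroupI)
      show "?I \<subseteq> carrier ?R" by blast
      show "?I \<noteq> {}" using zero_closed by (auto intro: exI[of _ 0])
      fix a assume a: "a \<in> ?I"
      then show "\<ominus>\<^bsub>?R\<^esub> a \<in> ?I" using a_inv_closed[of a] by (simp add: a_inv_poly_ring)
      fix b assume b: "b \<in> ?I"
      show "a \<oplus>\<^bsub>?R\<^esub> b \<in> ?I"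
        using a b add.m_closed[of a b] keys_add[of a b] by auto
    qed
  qed (use mult in \<open>auto simp: mult.commute\<close>)
qed

lemma ideal_mono_ideal: "ideal (mono_ideal V G) (poly_ring V :: ('a, 'k::comm_ring_1) mpoly ring)"
  unfolding mono_ideal_def
  by (rule ideal_by_keys) (meson mono_dvd_addI(2) mono_dvd_trans)

lemma ideal_sum_closed:
  assumes "ideal I (poly_ring V :: ('a, 'k::comm_ring_1) mpoly ring)" "\<And>i. i \<in> A \<Longrightarrow> f i \<in> I"
  shows "sum f A \<in> I"
proof -
  interpret ideal I "poly_ring V :: ('a, 'k) mpoly ring" by fact
  have zero: "0 \<in> I"
    using additive_subgroup.zero_closed[OF additive_subgroup_axioms] by simp
  have add: "x + y \<in> I" if "x \<in> I" "y \<in> I" for x y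
    using additive_subgroup.a_closed[OF additive_subgroup_axioms that] by simp
  show ?thesis using assms(2)
    by (induction A rule: infinite_finite_induct) (simp_all add: zero add)
qed

lemma single_eq_times_monom:
  assumes "mono_dvd a u"
  shows "Poly_Mapping.single u c = Poly_Mapping.single (u - a) c * (monom a :: ('a, 'k::comm_ring_1) mpoly)"
  using mono_diff_add_cancel[OF assms] by (simp add: mult_single)

text \<open>The right-hand side is an ideal containing the generators, which gives one inclusion.
  Conversely each term of an element is a multiple of one generator, and the cofactor still involves
  only variables in \<open>V\<close>.\<close>

lemma genideal_monom:
  assumes "\<And>a. a \<in> G \<Longrightarrow> keys a \<subseteq> V"
  shows "Idl\<^bsub>poly_ring V\<^esub> (monom ` G) = (mono_ideal V G :: ('a, 'k::comm_ring_1) mpoly set)"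
proof -
  let ?R = "poly_ring V :: ('a, 'k) mpoly ring"
  interpret cring ?R by (rule cring_poly_ring)
  have sub: "monom ` G \<subseteq> (mono_ideal V G :: ('a, 'k) mpoly set)"
    using assms by (simp add: mono_ideal_def in_carrier_poly_ring image_subset_iff) (use mono_dvd_refl in blast)
  then have carr: "monom ` G \<subseteq> carrier ?R" by (auto simp: mono_ideal_def)
  show ?thesis
  proof
    show "Idl\<^bsub>?R\<^esub> (monom ` G) \<subseteq> mono_ideal V G"
      using genideal_minimal[OF ideal_mono_ideal sub] .
    have I: "ideal (Idl\<^bsub>?R\<^esub> (monom ` G)) ?R" by (rule genideal_ideal[OF carr])
    show "mono_ideal V G \<subseteq> Idl\<^bsub>?R\<^esub> (monom ` G)"
    proof
      fix p :: "('a, 'k) mpoly" assume p: "p \<in> mono_ideal V G"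
      have "Poly_Mapping.single u (lookup p u) \<in> Idl\<^bsub>?R\<^esub> (monom ` G)" if u: "u \<in> keys p" for u
      proof -
        obtain a where a: "a \<in> G" "mono_dvd a u" using p u by (auto simp: mono_ideal_def)
        have "Poly_Mapping.single (u - a) (lookup p u) \<in> carrier ?R"
          using p u keys_diff_mono_subset[of u a] by (auto simp: mono_ideal_def in_carrier_poly_ring)
        moreover have "monom a \<in> Idl\<^bsub>?R\<^esub> (monom ` G)" using genideal_self[OF carr] a by blast
        ultimately show ?thesis
          unfolding single_eq_times_monom[OF a(2)] using ideal.I_l_closed[OF I] by (metis poly_ring_simps(1))
      qed
      then show "p \<in> Idl\<^bsub>?R\<^esub> (monom ` G)"
        by (subst poly_mapping_sum_single[of p]) (rule ideal_sum_closed[OF I])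
    qed
  qed
qed

lemma monom_in_mono_ideal:
  "(monom m :: ('a, 'k::comm_ring_1) mpoly) \<in> mono_ideal V G \<longleftrightarrow> keys m \<subseteq> V \<and> (\<exists>a\<in>G. mono_dvd a m)"
  by (simp add: mono_ideal_def in_carrier_poly_ring)

lemma mingens_mono_ideal:
  assumes "\<And>a. a \<in> G \<Longrightarrow> keys a \<subseteq> V" "\<And>a b. a \<in> G \<Longrightarrow> b \<in> G \<Longrightarrow> mono_dvd a b \<Longrightarrow> a = b"
  shows "mingens (mono_ideal V G :: ('a, 'k::comm_ring_1) mpoly set) = G"
proof (intro equalityI subsetI)
  fix m assume "m \<in> mingens (mono_ideal V G :: ('a, 'k) mpoly set)"
  then obtain a where a: "a \<in> G" "mono_dvd a m"
    and min: "\<And>m'. keys m' \<subseteq> V \<Longrightarrow> \<exists>a\<in>G. mono_dvd a m' \<Longrightarrow> mono_dvd m' m \<Longrightarrow> m' = m"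
    unfolding mingens_def monom_in_mono_ideal by blast
  have "a = m" using min[of a] a assms(1) mono_dvd_refl by blast
  then show "m \<in> G" using a by simp
next
  fix m assume m: "m \<in> G"
  have "m' = m" if "a \<in> G" "mono_dvd a m'" "mono_dvd m' m" for a m'
    using assms(2)[OF that(1) m] that mono_dvd_trans mono_dvd_antisym by blast
  then show "m \<in> mingens (mono_ideal V G :: ('a, 'k) mpoly set)"
    using m assms(1) mono_dvd_refl unfolding mingens_def monom_in_mono_ideal by blast
qed

section \<open>Squarefree powers of edge ideals\<close>

lemma simple_graph_finite:
  assumes "simple_graph V E"
  shows "finite V" "finite E" "\<And>e. e \<in> E \<Longrightarrow> finite e" "\<And>e. e \<in> E \<Longrightarrow> card e = 2" "\<And>e. e \<in> E \<Longrightarrow> e \<subseteq> V"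
proof -
  show V: "finite V" and sub: "\<And>e. e \<in> E \<Longrightarrow> e \<subseteq> V" and "\<And>e. e \<in> E \<Longrightarrow> card e = 2"
    using assms by (auto simp: simple_graph_def)
  show "finite E" by (rule finite_subset[of E "Pow V"]) (use V sub in auto)
  show "\<And>e. e \<in> E \<Longrightarrow> finite e" using V sub by (meson finite_subset)
qed

lemma simple_graph_edge_neq: "simple_graph V E \<Longrightarrow> {x, y} \<in> E \<Longrightarrow> x \<noteq> y"
  using simple_graph_finite(4)[of V E "{x, y}"] by auto

lemma matching_subset: "matching E M \<Longrightarrow> N \<subseteq> M \<Longrightarrow> matching E N"
  unfolding matching_def by (meson order_trans pairwise_subset)

lemma matching_insert:
  assumes "matching E M" "e \<in> E" "e \<inter> \<Union>M = {}"
  shows "matching E (insert e M)"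
  using assms by (auto simp: matching_def pairwise_insert disjnt_def)

lemma matching_card_Union:
  assumes "simple_graph V E" "matching E M"
  shows "card (\<Union>M) = 2 * card M" "finite M" "\<Union>M \<subseteq> V" "finite (\<Union>M)"
proof -
  note sg = simple_graph_finite[OF assms(1)]
  have M: "M \<subseteq> E" "pairwise disjnt M" using assms(2) by (auto simp: matching_def)
  show fin: "finite M" using M(1) sg(2) by (meson finite_subset)
  show "\<Union>M \<subseteq> V" using M(1) sg(5) by blast
  then show "finite (\<Union>M)" using sg(1) finite_subset by blast
  have "card (\<Union>M) = (\<Sum>e\<in>M. card e)"
    by (rule card_Union_disjoint) (use M sg in auto)
  also have "\<dots> = (\<Sum>e\<in>M. 2)" by (rule sum.cong) (use M sg in auto)
  finally show "card (\<Union>M) = 2 * card M" by simp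
qed

text \<open>Sets rather than matchings: two matchings with the same vertex set have the same product
  of edges and yield one generator.\<close>

definition matched_sets :: "'a set set \<Rightarrow> nat \<Rightarrow> 'a set set" where
  "matched_sets E n = {\<Union>M | M. matching E M \<and> card M = n}"

lemma matched_sets_props:
  assumes "simple_graph V E" "S \<in> matched_sets E n"
  shows "finite S" "S \<subseteq> V" "card S = 2 * n"
proof -
  obtain M where "S = \<Union>M" "matching E M" "card M = n" using assms(2) by (auto simp: matched_sets_def)
  then show "finite S" "S \<subseteq> V" "card S = 2 * n" using matching_card_Union[OF assms(1)] by blast+
qed

lemma matched_sets_subset_eq:
  assumes "simple_graph V E" "S \<in> matched_sets E n" "T \<in> matched_sets E n" "S \<subseteq> T"
  shows "S = T"
  using matched_sets_props[OF assms(1,2)] matched_sets_props[OF assms(1,3)] assms(4)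
  by (simp add: card_subset_eq)

lemma finite_matched_sets: "simple_graph V E \<Longrightarrow> finite (matched_sets E n)"
  by (rule finite_subset[of _ "Pow V"]) (use matched_sets_props(2) simple_graph_finite(1) in blast)+

lemma edge_ideal_eq:
  assumes "simple_graph V E"
  shows "edge_ideal V E = (mono_ideal V (set_mono ` E) :: ('a, 'k::comm_ring_1) mpoly set)"
proof -
  have "{var x * var y | x y. {x, y} \<in> E} = (monom ` set_mono ` E :: ('a, 'k) mpoly set)"
  proof (intro equalityI subsetI)
    fix p :: "('a, 'k) mpoly" assume "p \<in> {var x * var y | x y. {x, y} \<in> E}"
    then obtain x y where xy: "p = var x * var y" "{x, y} \<in> E" by blast
    then have "p = monom (set_mono {x, y})"
      using simple_graph_edge_neq[OF assms xy(2)] by (simp add: set_mono_def mult_single)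
    then show "p \<in> monom ` set_mono ` E" using xy(2) by blast
  next
    fix p :: "('a, 'k) mpoly" assume "p \<in> monom ` set_mono ` E"
    then obtain e where e: "e \<in> E" "p = monom (set_mono e)" by blast
    obtain x y where xy: "e = {x, y}" "x \<noteq> y"
      using simple_graph_finite(4)[OF assms e(1)] by (meson card_2_iff)
    then have "p = var x * var y" using e by (simp add: set_mono_def mult_single)
    then show "p \<in> {var x * var y | x y. {x, y} \<in> E}" using e xy by blast
  qed
  then show ?thesis
    unfolding edge_ideal_def
    by (simp only:) (rule genideal_monom, use simple_graph_finite(3,5)[OF assms] keys_set_mono in blast)
qed

lemma ideal_edge_ideal_power:
  assumes "simple_graph V E"
  shows "ideal (edge_ideal V E [^]\<^bsub>ideals_set (poly_ring V)\<^esub> (n::nat)) (poly_ring V :: ('a, 'k::comm_ring_1) mpoly ring)"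
proof -
  interpret cring "poly_ring V :: ('a, 'k) mpoly ring" by (rule cring_poly_ring)
  interpret IS: comm_monoid "ideals_set (poly_ring V :: ('a, 'k) mpoly ring)"
    by (rule ideals_set_is_comm_monoid)
  have "edge_ideal V E \<in> carrier (ideals_set (poly_ring V :: ('a, 'k) mpoly ring))"
    unfolding edge_ideal_eq[OF assms] by (simp add: ideals_set_def ideal_mono_ideal)
  then show ?thesis using IS.nat_pow_closed[of "edge_ideal V E" n] by (simp add: ideals_set_def)
qed

text \<open>The ideal product consists of sums, in which terms may cancel, so the claim concerns
  every squarefree term of every element; a term of a sum is a term of a summand. A squarefree term
  of a product splits into factors with disjoint supports, so an edge below the second factor can be
  added to the matching found below the first.\<close>

lemma squarefree_mono_of_edge_ideal_power:
  assumes "simple_graph V E"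
    and "p \<in> edge_ideal V E [^]\<^bsub>ideals_set (poly_ring V :: ('a, 'k::comm_ring_1) mpoly ring)\<^esub> (n::nat)"
    and "u \<in> keys p" "squarefree_mono u"
  shows "\<exists>S\<in>matched_sets E n. S \<subseteq> keys u"
  using assms(2-4)
proof (induction n arbitrary: p u)
  case 0
  have "{} \<in> matched_sets E 0"
    unfolding matched_sets_def by (force simp: matching_def)
  then show ?case by blast
next
  case (Suc n)
  have "p \<in> ideal_prod (poly_ring V) (edge_ideal V E [^]\<^bsub>ideals_set (poly_ring V)\<^esub> n) (edge_ideal V E)"
    using Suc.prems(1) by (simp add: nat_pow_def ideals_set_def)
  then show ?case using Suc.prems(2,3)
  proof (induction p arbitrary: u rule: ideal_prod.induct)
    case (prod i j)
    obtain a b where ab: "u = a + b" "a \<in> keys i" "b \<in> keys j"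
      using keys_mult[of i j] prod.prems(1) by auto
    note sf = squarefree_mono_add[OF prod.prems(2)[unfolded ab(1)]]
    obtain S where S: "S \<in> matched_sets E n" "S \<subseteq> keys a"
      using Suc.IH[OF prod.hyps(1) ab(2) sf(1)] by blast
    obtain e where e: "e \<in> E" "e \<subseteq> keys b"
      using prod.hyps(2) ab(3) simple_graph_finite(3)[OF assms(1)]
      unfolding edge_ideal_eq[OF assms(1)] by (auto simp: mono_ideal_def set_mono_dvd_iff)
    obtain M where M: "matching E M" "card M = n" "S = \<Union>M" using S by (auto simp: matched_sets_def)
    have disj: "e \<inter> \<Union>M = {}" using sf(3) S(2) e(2) M(3) by blast
    then have "e \<notin> M" using simple_graph_finite(4)[OF assms(1) e(1)] by (cases "e = {}") auto
    then have "card (insert e M) = Suc n"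
      using M(2) matching_card_Union(2)[OF assms(1) M(1)] by simp
    then have "\<Union>(insert e M) \<in> matched_sets E (Suc n)"
      using matching_insert[OF M(1) e(1) disj] unfolding matched_sets_def by blast
    moreover have "\<Union>(insert e M) \<subseteq> keys u"
      using S(2) M(3) e(2) by (auto simp: ab(1) keys_add_mono)
    ultimately show ?case by blast
  next
    case (sum s1 s2)
    then show ?case using keys_add[of s1 s2] by auto
  qed
qed

lemma monom_set_mono_in_edge_ideal_power:
  assumes "simple_graph V E" "S \<in> matched_sets E n"
  shows "(monom (set_mono S) :: ('a, 'k::comm_ring_1) mpoly) \<in> edge_ideal V E [^]\<^bsub>ideals_set (poly_ring V)\<^esub> n"
  using assms(2)
proof (induction n arbitrary: S)
  case 0
  then have "S = {}"
    using matched_sets_props[OF assms(1), of S 0] by simp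
  then show ?case by (simp add: nat_pow_def ideals_set_def in_carrier_poly_ring set_mono_def)
next
  case (Suc n)
  obtain M where M: "matching E M" "card M = Suc n" "S = \<Union>M" using Suc.prems by (auto simp: matched_sets_def)
  obtain e N where N: "M = insert e N" "e \<notin> N" "card N = n" using card_eq_SucD[OF M(2)] by metis
  have mN: "matching E N" using M(1) N(1) by (meson matching_subset subset_insertI)
  have e: "e \<in> E" and disj: "\<Union>N \<inter> e = {}"
    using M(1) N(1,2) by (auto simp: matching_def pairwise_insert disjnt_def)
  have "\<Union>N \<in> matched_sets E n" using mN N(3) by (auto simp: matched_sets_def)
  from Suc.IH[OF this] have 1: "monom (set_mono (\<Union>N)) \<in> edge_ideal V E [^]\<^bsub>ideals_set (poly_ring V :: ('a, 'k) mpoly ring)\<^esub> n" .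
  have 2: "(monom (set_mono e) :: ('a, 'k) mpoly) \<in> edge_ideal V E"
    unfolding edge_ideal_eq[OF assms(1)] monom_in_mono_ideal
    using e simple_graph_finite(3,5)[OF assms(1) e] mono_dvd_refl by (simp only: keys_set_mono) blast
  have "set_mono S = set_mono (\<Union>N) + set_mono e"
    unfolding M(3) N(1) using set_mono_union_disjoint[OF _ _ disj] matching_card_Union(4)[OF assms(1) mN]
      simple_graph_finite(3)[OF assms(1) e] by (simp add: Un_commute)
  then have "(monom (set_mono S) :: ('a, 'k) mpoly) = monom (set_mono (\<Union>N)) \<otimes>\<^bsub>poly_ring V\<^esub> monom (set_mono e)"
    by (simp add: mult_single)
  then show ?case using ideal_prod.prod[OF 1 2, of "poly_ring V"]
    by (simp add: nat_pow_def ideals_set_def)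
qed

lemma mono_ideal_mono:
  assumes "\<And>m. m \<in> G \<Longrightarrow> \<exists>a\<in>H. mono_dvd a m"
  shows "mono_ideal V G \<subseteq> (mono_ideal V H :: ('a, 'k::comm_ring_1) mpoly set)"
proof
  fix p :: "('a, 'k) mpoly" assume p: "p \<in> mono_ideal V G"
  have "\<exists>a\<in>H. mono_dvd a u" if u: "u \<in> keys p" for u
  proof -
    obtain m where m: "m \<in> G" "mono_dvd m u" using p u by (auto simp: mono_ideal_def)
    then show ?thesis using assms[OF m(1)] mono_dvd_trans by blast
  qed
  then show "p \<in> mono_ideal V H" using p by (simp add: mono_ideal_def)
qed

text \<open>The squarefree monomials of the power are in general more than those of the matched
  sets, but each of the two families dominates the other under divisibility, and
  \<open>mono_ideal\<close> depends on nothing else.\<close>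

lemma squarefree_power_eq:
  assumes "simple_graph V E"
  shows "squarefree_power V (edge_ideal V E) n = (mono_ideal V (set_mono ` matched_sets E n) :: ('a, 'k::comm_ring_1) mpoly set)"
proof -
  let ?R = "poly_ring V :: ('a, 'k) mpoly ring"
  let ?I = "edge_ideal V E [^]\<^bsub>ideals_set ?R\<^esub> n"
  let ?G = "{m. squarefree_mono m \<and> monom m \<in> ?I}"
  have sub: "set_mono ` matched_sets E n \<subseteq> ?G"
    using monom_set_mono_in_edge_ideal_power[OF assms] squarefree_set_mono matched_sets_props(1)[OF assms] by blast
  have low: "\<exists>a\<in>set_mono ` matched_sets E n. mono_dvd a m" if m: "m \<in> ?G" for m
  proof -
    obtain S where S: "S \<in> matched_sets E n" "S \<subseteq> keys m"
      using squarefree_mono_of_edge_ideal_power[OF assms, of "monom m :: ('a, 'k) mpoly" n m] m by auto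
    then have "mono_dvd (set_mono S) m"
      by (simp add: set_mono_dvd_iff matched_sets_props(1)[OF assms])
    then show ?thesis using S(1) by blast
  qed
  have "monom m \<in> carrier ?R" if "m \<in> ?G" for m
    using that ideal.Icarr[OF ideal_edge_ideal_power[OF assms]] by blast
  then have G: "keys m \<subseteq> V" if "m \<in> ?G" for m
    using that by (simp add: in_carrier_poly_ring)
  have "{monom m | m. squarefree_mono m \<and> monom m \<in> ?I} = (monom ` ?G :: ('a, 'k) mpoly set)"
    by (rule setcompr_eq_image)
  then have "squarefree_power V (edge_ideal V E) n = Idl\<^bsub>?R\<^esub> (monom ` ?G)"
    unfolding squarefree_power_def by (rule arg_cong)
  also have "\<dots> = mono_ideal V ?G" by (rule genideal_monom) (rule G)
  also have "\<dots> = mono_ideal V (set_mono ` matched_sets E n)"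
  proof (rule equalityI)
    show "mono_ideal V ?G \<subseteq> (mono_ideal V (set_mono ` matched_sets E n) :: ('a, 'k) mpoly set)"
      by (rule mono_ideal_mono) (rule low)
    show "(mono_ideal V (set_mono ` matched_sets E n) :: ('a, 'k) mpoly set) \<subseteq> mono_ideal V ?G"
      by (rule mono_ideal_mono) (rule bexI[OF mono_dvd_refl subsetD[OF sub]])
  qed
  finally show ?thesis .
qed

section \<open>The Taylor differential\<close>

lemma mono_order_cases:
  assumes "p \<noteq> (q :: 'a mono)"
  shows "(p, q) \<in> mono_order \<longleftrightarrow> (q, p) \<notin> mono_order"
proof -
  have "total_on UNIV (mono_order :: 'a mono rel)" "antisym (mono_order :: 'a mono rel)"
    using linear_order_mono_order by (auto simp: linear_order_on_def partial_order_on_def)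
  then show ?thesis using assms unfolding total_on_def antisym_def by blast
qed

lemma mono_order_trans: "(p, q) \<in> mono_order \<Longrightarrow> (q, r) \<in> mono_order \<Longrightarrow> (p, r) \<in> mono_order"
  using linear_order_mono_order
  by (auto simp: linear_order_on_def partial_order_on_def preorder_on_def dest: transD)

definition mono_pos :: "'a mono set \<Rightarrow> 'a mono \<Rightarrow> nat" where
  "mono_pos \<sigma> m = card {m'\<in>\<sigma>. m' \<noteq> m \<and> (m', m) \<in> mono_order}"

lemma minus_one_power_times: "(- 1) ^ k * Poly_Mapping.single t c = (Poly_Mapping.single t ((- 1) ^ k * c) :: ('a, 'k::comm_ring_1) mpoly)"
  by (cases "even k") (simp_all add: single_uminus)

lemma taylor_coeff_eq:
  "taylor_coeff \<sigma> m = (Poly_Mapping.single (mono_lcm \<sigma> - mono_lcm (\<sigma> - {m})) ((- 1) ^ mono_pos \<sigma> m) :: ('a, 'k::comm_ring_1) mpoly)"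
  by (simp add: taylor_coeff_def mono_pos_def minus_one_power_times)

lemma mono_pos_pair:
  assumes "p \<noteq> q"
  shows "(- 1 :: 'k::comm_ring_1) ^ mono_pos {p, q} q = - ((- 1) ^ mono_pos {p, q} p)"
proof -
  have "{m'\<in>{p, q}. m' \<noteq> q \<and> (m', q) \<in> mono_order} = (if (p, q) \<in> mono_order then {p} else {})"
    "{m'\<in>{p, q}. m' \<noteq> p \<and> (m', p) \<in> mono_order} = (if (q, p) \<in> mono_order then {q} else {})"
    using assms by auto
  then show ?thesis using mono_order_cases[OF assms] by (simp add: mono_pos_def)
qed

lemma lookup_taylor_diff:
  "lookup (taylor_diff g) \<tau> =
    (\<Sum>\<sigma>\<in>keys g. \<Sum>m\<in>\<sigma>. if \<sigma> - {m} = \<tau> then lookup g \<sigma> * taylor_coeff \<sigma> m else 0)"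
  by (simp add: taylor_diff_def lookup_sum lookup_single when_def)

lemma taylor_diff_add: "taylor_diff (f + g) = taylor_diff f + taylor_diff g"
  unfolding taylor_diff_def
  by (rule setsum_keys_plus_distrib) (simp_all add: distrib_right single_add sum.distrib)

lemma taylor_diff_diff: "taylor_diff (f - g) = taylor_diff f - taylor_diff g"
  using taylor_diff_add[of "f - g" g] by simp

lemma taylor_diff_0 [simp]: "taylor_diff 0 = 0"
  by (simp add: taylor_diff_def)

lemma taylor_diff_sum: "taylor_diff (sum f A) = (\<Sum>i\<in>A. taylor_diff (f i))"
  by (induction A rule: infinite_finite_induct) (simp_all add: taylor_diff_add)

lemma taylor_diff_single:
  "taylor_diff (Poly_Mapping.single \<sigma> c) = (\<Sum>m\<in>\<sigma>. Poly_Mapping.single (\<sigma> - {m}) (c * taylor_coeff \<sigma> m))"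
  by (cases "c = 0") (simp_all add: taylor_diff_def)

text \<open>The coefficients in multidegree \<open>W\<close>: the multigraded strand of the Taylor complex is the
  simplicial chain complex of the faces whose least common multiple divides \<open>W\<close>.\<close>

definition strand :: "'a mono \<Rightarrow> ('a mono set \<Rightarrow>\<^sub>0 ('a, 'k::comm_ring_1) mpoly) \<Rightarrow> 'a mono set \<Rightarrow> 'k" where
  "strand W f \<sigma> = (if mono_dvd (mono_lcm \<sigma>) W then lookup (lookup f \<sigma>) (W - mono_lcm \<sigma>) else 0)"

lemma strand_add: "strand W (f + g) \<sigma> = strand W f \<sigma> + strand W g \<sigma>"
  by (simp add: strand_def lookup_add)

lemma strand_diff: "strand W (f - g) \<sigma> = strand W f \<sigma> - strand W g \<sigma>"
  by (simp add: strand_def lookup_minus)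

lemma strand_single:
  assumes "mono_dvd (mono_lcm \<sigma>) W"
  shows "strand W (Poly_Mapping.single \<sigma> (Poly_Mapping.single (W - mono_lcm \<sigma>) c)) \<tau> = (if \<sigma> = \<tau> then c else 0)"
  using assms by (auto simp: strand_def lookup_single when_def)

text \<open>The cancellation \<open>w - a - (b - a) = w - b\<close> survives truncated subtraction
  because \<open>a\<close> divides both \<open>b\<close> and \<open>w\<close>. It makes the lcm
  quotient in a Taylor coefficient invisible within one multidegree.\<close>

lemma lookup_times_single_strand:
  fixes p :: "('a, 'k::comm_ring_1) mpoly"
  assumes "mono_dvd a b" "mono_dvd a w"
  shows "lookup (p * Poly_Mapping.single (b - a) c) (w - a) = (if mono_dvd b w then lookup p (w - b) * c else 0)"
proof -
  have le: "lookup a v \<le> lookup b v" "lookup a v \<le> lookup w v" for v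
    using assms by (auto simp: mono_dvd_def)
  have "lookup b v - lookup a v \<le> lookup w v - lookup a v \<longleftrightarrow> lookup b v \<le> lookup w v" for v
    using le[of v] by linarith
  then have "mono_dvd (b - a) (w - a) \<longleftrightarrow> mono_dvd b w"
    by (simp add: mono_dvd_def lookup_minus)
  moreover have "w - a - (b - a) = w - b"
    using le by (intro poly_mapping_eqI) (simp add: lookup_minus)
  ultimately show ?thesis by (simp add: lookup_times_single)
qed

text \<open>Within one multidegree the Taylor differential becomes the simplicial boundary with
  constant coefficients: only the signs are left.\<close>

lemma strand_taylor_diff:
  assumes "\<And>\<sigma>. \<sigma> \<in> keys g \<Longrightarrow> finite \<sigma>"
  shows "strand W (taylor_diff g) \<tau> =
    (\<Sum>\<sigma>\<in>keys g. \<Sum>m\<in>\<sigma>. if \<sigma> - {m} = \<tau> then (- 1) ^ mono_pos \<sigma> m * strand W g \<sigma> else 0)"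
proof -
  have dvd: "mono_dvd (mono_lcm (\<sigma> - {m})) (mono_lcm \<sigma>)" if "\<sigma> \<in> keys g" for \<sigma> m
    using mono_lcm_mono[OF assms[OF that]] by blast
  show ?thesis
  proof (cases "mono_dvd (mono_lcm \<tau>) W")
    case True
    have "lookup (lookup g \<sigma> * taylor_coeff \<sigma> m) (W - mono_lcm \<tau>) = (- 1) ^ mono_pos \<sigma> m * strand W g \<sigma>"
      if "\<sigma> \<in> keys g" "\<sigma> - {m} = \<tau>" for \<sigma> m
    proof -
      have d: "mono_dvd (mono_lcm \<tau>) (mono_lcm \<sigma>)" using dvd[OF that(1), of m] that(2) by simp
      show ?thesis
        unfolding taylor_coeff_eq that(2) lookup_times_single_strand[OF d True]
        by (simp add: strand_def)
    qed
    then show ?thesis using True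
      by (auto simp: strand_def[of W "taylor_diff g"] lookup_taylor_diff lookup_sum intro!: sum.cong)
  next
    \<comment> \<open>A face whose lcm does not divide \<open>W\<close> is not in the boundary of
      one whose lcm does, since lcms grow with the face.\<close>
    case False
    have "strand W g \<sigma> = 0" if "\<sigma> \<in> keys g" "\<sigma> - {m} = \<tau>" for \<sigma> m
      using dvd[OF that(1), of m] that(2) False mono_dvd_trans by (auto simp: strand_def)
    then show ?thesis using False
      unfolding strand_def[of W "taylor_diff g"] by (auto intro!: sum.neutral sum.neutral[symmetric])
  qed
qed


section \<open>Necessary conditions for Scarf ideals\<close>

text \<open>The edge from \<open>p\<close> to \<open>q\<close> in multidegree \<open>W\<close>,
  oriented independently of \<open>mono_order\<close>: the sign cancels the one in the differential,
  and the boundary is always end point minus starting point.\<close>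

definition edge_chain :: "'a mono \<Rightarrow> 'a mono \<Rightarrow> 'a mono \<Rightarrow> ('a mono set \<Rightarrow>\<^sub>0 ('a, 'k::comm_ring_1) mpoly)" where
  "edge_chain W p q =
     Poly_Mapping.single {p, q} (Poly_Mapping.single (W - mono_lcm {p, q}) ((- 1) ^ mono_pos {p, q} p))"

definition vertex_chain :: "'a mono \<Rightarrow> 'a mono \<Rightarrow> ('a mono set \<Rightarrow>\<^sub>0 ('a, 'k::comm_ring_1) mpoly)" where
  "vertex_chain W p = Poly_Mapping.single {p} (monom (W - p))"

lemma mono_diff_diff_add:
  assumes "mono_dvd a b" "mono_dvd b w"
  shows "(w - b) + (b - a) = w - a"
  using assms by (intro poly_mapping_eqI) (simp add: mono_dvd_def lookup_add lookup_minus)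

lemma taylor_diff_edge_chain:
  assumes "p \<noteq> q" "mono_dvd p W" "mono_dvd q W"
  shows "taylor_diff (edge_chain W p q :: 'a mono set \<Rightarrow>\<^sub>0 ('a, 'k::comm_ring_1) mpoly) = vertex_chain W q - vertex_chain W p"
proof -
  let ?l = "mono_lcm {p, q}"
  have d: "mono_dvd p ?l" "mono_dvd q ?l" "mono_dvd ?l W"
    using assms by (auto simp: mono_dvd_lcm mono_lcm_dvd_iff)
  have e: "{p, q} - {p} = {q}" "{p, q} - {q} = {p}" using assms(1) by auto
  have s: "(- 1 :: 'k) ^ k * (- 1) ^ k = 1" for k by (simp flip: power_add)
  show ?thesis
    using assms(1) mono_diff_diff_add[OF d(1,3)] mono_diff_diff_add[OF d(2,3)]
    by (simp add: edge_chain_def taylor_diff_single e vertex_chain_def taylor_coeff_eq mult_single s mono_pos_pair[OF assms(1)]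
        single_uminus)
qed

text \<open>The right-hand side does not depend on \<open>p\<close>, so a difference of two vertex
  chains in the same multidegree is a cycle.\<close>

lemma taylor_diff_vertex_chain:
  assumes "mono_dvd p W"
  shows "taylor_diff (vertex_chain W p :: 'a mono set \<Rightarrow>\<^sub>0 ('a, 'k::comm_ring_1) mpoly) = Poly_Mapping.single {} (monom W)"
proof -
  have "mono_pos {p} p = 0" by (auto simp: mono_pos_def)
  then show ?thesis
    using mono_diff_add_cancel[OF assms]
    by (simp add: vertex_chain_def taylor_diff_single taylor_coeff_eq mult_single)
qed

lemma strand_vertex_chain:
  assumes "mono_dvd p W"
  shows "strand W (vertex_chain W p) {c} = (if p = c then 1 else 0)"
  using assms strand_single[of "{p}" W 1 "{c}"] by (simp add: vertex_chain_def)

lemma mingens_dvd_eq: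
  assumes "a \<in> mingens I" "b \<in> mingens I" "mono_dvd a b"
  shows "a = b"
  using assms by (auto simp: mingens_def)

text \<open>A set of generators with lcm \<open>a\<close> can contain only \<open>a\<close>, by
  minimality. What remains to be excluded is the empty set, whose lcm is the exponent vector 0;
  hence the assumption \<open>a \<noteq> 0\<close>.\<close>

lemma singleton_in_scarf_complex:
  assumes "a \<in> mingens I" "a \<noteq> 0" "finite (mingens I)"
  shows "{a} \<in> scarf_complex I"
proof -
  have "mono_lcm {a} \<noteq> mono_lcm \<tau>" if "\<tau> \<subseteq> mingens I" "\<tau> \<noteq> {a}" for \<tau>
  proof
    assume eq: "mono_lcm {a} = mono_lcm \<tau>"
    have fin: "finite \<tau>" using that(1) assms(3) finite_subset by blast
    have "m = a" if "m \<in> \<tau>" for m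
      using mono_dvd_lcm[OF fin that] mingens_dvd_eq[of m I a] assms(1) \<open>\<tau> \<subseteq> mingens I\<close> that eq by auto
    then have "\<tau> = {}" using that(2) by blast
    then show False using eq assms(2) by simp
  qed
  then show ?thesis using assms(1) unfolding scarf_complex_def by blast
qed

section \<open>Membership in the modules of the Scarf complex\<close>

lemma single_in_scarf_module:
  assumes "\<sigma> \<in> scarf_complex I" "card \<sigma> = i" "keys u \<subseteq> V"
  shows "Poly_Mapping.single \<sigma> (Poly_Mapping.single u c) \<in> scarf_module V I i"
  using assms by (auto simp: scarf_module_def free_module_def in_carrier_poly_ring lookup_single when_def split: if_splits)

lemma scarf_module_add:
  assumes "f \<in> scarf_module V I i" "g \<in> scarf_module V I i"
  shows "f + g \<in> scarf_module V I i"
  using assms keys_add[of f g] keys_add[of "lookup f b" "lookup g b" for b]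
  by (force simp: scarf_module_def free_module_def in_carrier_poly_ring lookup_add)

lemma scarf_module_uminus:
  assumes "f \<in> scarf_module V I i"
  shows "- f \<in> scarf_module V I i"
  using assms by (auto simp: scarf_module_def free_module_def in_carrier_poly_ring)

lemma scarf_module_diff:
  assumes "f \<in> scarf_module V I i" "g \<in> scarf_module V I i"
  shows "f - g \<in> scarf_module V I i"
  using scarf_module_add[OF assms(1) scarf_module_uminus[OF assms(2)]] by simp

lemma scarf_moduleD:
  assumes "f \<in> scarf_module V I i" "\<sigma> \<in> keys f"
  shows "\<sigma> \<in> scarf_complex I" "card \<sigma> = i"
  using assms by (auto simp: scarf_module_def free_module_def)

lemma scarf_resolution_exact:
  assumes "scarf_is_resolution V I" "i \<ge> 1" "f \<in> scarf_module V I i" "taylor_diff f = 0"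
  shows "\<exists>g\<in>scarf_module V I (Suc i). f = taylor_diff g"
proof -
  have "f \<in> taylor_diff ` scarf_module V I (Suc i)"
    using assms unfolding scarf_is_resolution_def by blast
  then show ?thesis by blast
qed

text \<open>Exactness in homological degree 1: the Scarf edges within a multidegree form a connected
  graph. Otherwise summing the \<open>W\<close>-strand over a union \<open>C\<close> of components annihilates all
  boundaries, but not the cycle joining a point of \<open>C\<close> to a point outside.\<close>

lemma scarf_connected:
  fixes I :: "('a, 'k::comm_ring_1) mpoly set"
  assumes res: "scarf_is_resolution V I" and fin: "finite (mingens I)" and nz: "0 \<notin> mingens I"
    and W: "keys W \<subseteq> V" and C: "C \<subseteq> mingens I" "\<And>c. c \<in> C \<Longrightarrow> mono_dvd c W"
    and a: "a \<in> C" and b: "b \<in> mingens I" "mono_dvd b W" "b \<notin> C"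
  shows "\<exists>p\<in>C. \<exists>q\<in>mingens I - C. mono_dvd q W \<and> {p, q} \<in> scarf_complex I"
proof (rule ccontr)
  assume *: "\<not> ?thesis"
  let ?f = "vertex_chain W a - vertex_chain W b :: 'a mono set \<Rightarrow>\<^sub>0 ('a, 'k) mpoly"
  have vert: "(vertex_chain W c :: 'a mono set \<Rightarrow>\<^sub>0 ('a, 'k) mpoly) \<in> scarf_module V I 1" if "c \<in> mingens I" for c
    unfolding vertex_chain_def using that nz fin keys_diff_mono_subset[of W c] W
    by (intro single_in_scarf_module singleton_in_scarf_complex) auto
  have aI: "a \<in> mingens I" "mono_dvd a W" using a C by auto
  have "taylor_diff ?f = 0"
    using aI b by (simp add: taylor_diff_diff taylor_diff_vertex_chain)
  then obtain g where g: "g \<in> scarf_module V I 2" "?f = taylor_diff g"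
    using scarf_resolution_exact[OF res, of 1 ?f] scarf_module_diff[OF vert vert, OF aI(1) b(1)]
    by (auto simp: numeral_2_eq_2)
  have finC: "finite C" using C(1) fin finite_subset by blast
  have fing: "finite \<sigma>" if "\<sigma> \<in> keys g" for \<sigma>
    using scarf_moduleD[OF g(1) that] by (auto intro: card_ge_0_finite)
  \<comment> \<open>By the assumption to be refuted, an edge of \<open>g\<close> inside
    \<open>W\<close> has both ends in \<open>C\<close> or neither; in the first case its two end
    points contribute opposite signs.\<close>
  have zero: "(\<Sum>m\<in>\<sigma>. \<Sum>c\<in>C. if \<sigma> - {m} = {c} then (- 1) ^ mono_pos \<sigma> m * strand W g \<sigma> else 0) = 0"
    if \<sigma>: "\<sigma> \<in> keys g" for \<sigma>
  proof (cases "mono_dvd (mono_lcm \<sigma>) W")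
    case False
    then have "strand W g \<sigma> = 0" by (simp add: strand_def)
    then show ?thesis by (simp cong: if_cong)
  next
    case True
    obtain p q where pq: "\<sigma> = {p, q}" "p \<noteq> q"
      using scarf_moduleD(2)[OF g(1) \<sigma>] by (meson card_2_iff)
    have sc: "{p, q} \<in> scarf_complex I" using scarf_moduleD(1)[OF g(1) \<sigma>] pq by simp
    then have m: "p \<in> mingens I" "q \<in> mingens I" by (auto simp: scarf_complex_def)
    have w: "mono_dvd p W" "mono_dvd q W" using True pq by (auto simp: mono_lcm_dvd_iff)
    have iff: "p \<in> C \<longleftrightarrow> q \<in> C"
      using * sc m w by (metis DiffI insert_commute)
    have e: "{p, q} - {p} = {q}" "{p, q} - {q} = {p}" using pq(2) by auto
    show ?thesis
      unfolding pq(1) using pq(2) finC iff by (simp add: e mono_pos_pair[OF pq(2)])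
  qed
  have "(\<Sum>c\<in>C. strand W ?f {c}) = (\<Sum>c\<in>C. \<Sum>\<sigma>\<in>keys g. \<Sum>m\<in>\<sigma>. if \<sigma> - {m} = {c} then (- 1) ^ mono_pos \<sigma> m * strand W g \<sigma> else 0)"
    unfolding g(2) using strand_taylor_diff[of g W, OF fing] by simp
  also have "\<dots> = (\<Sum>\<sigma>\<in>keys g. \<Sum>c\<in>C. \<Sum>m\<in>\<sigma>. if \<sigma> - {m} = {c} then (- 1) ^ mono_pos \<sigma> m * strand W g \<sigma> else 0)"
    by (rule sum.swap)
  also have "\<dots> = (\<Sum>\<sigma>\<in>keys g. 0)"
    by (intro sum.cong refl) (subst sum.swap, rule zero)
  finally have "(\<Sum>c\<in>C. strand W ?f {c}) = 0" by simp
  \<comment> \<open>The functional is 1 on the cycle, because \<open>C\<close> contains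
    \<open>a\<close> but not \<open>b\<close>.\<close>
  moreover have "(\<Sum>c\<in>C. strand W ?f {c}) = (\<Sum>c\<in>C. if a = c then 1 else 0)"
    using aI b by (intro sum.cong refl) (auto simp: strand_diff strand_vertex_chain)
  ultimately show False using a finC by simp
qed

text \<open>The sum of the four oriented edges is a cycle. If no Scarf triangle has an lcm dividing
  \<open>W\<close>, every chain in degree 3 has zero strand at \<open>W\<close>, so its boundary has
  coefficient 0 at \<open>{p, q}\<close>; the square has a sign there.\<close>

lemma scarf_no_empty_square:
  fixes I :: "('a, 'k::comm_ring_1) mpoly set"
  assumes res: "scarf_is_resolution V I"
    and W: "keys W \<subseteq> V" "mono_dvd p W" "mono_dvd q W" "mono_dvd r W" "mono_dvd s W"
    and dist: "distinct [p, q, r, s]"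
    and sc: "{p, q} \<in> scarf_complex I" "{q, r} \<in> scarf_complex I" "{r, s} \<in> scarf_complex I" "{s, p} \<in> scarf_complex I"
  shows "\<exists>\<sigma>\<in>scarf_complex I. card \<sigma> = 3 \<and> mono_dvd (mono_lcm \<sigma>) W"
proof (rule ccontr)
  assume *: "\<not> ?thesis"
  let ?f = "edge_chain W p q + edge_chain W q r + edge_chain W r s + edge_chain W s p :: 'a mono set \<Rightarrow>\<^sub>0 ('a, 'k) mpoly"
  have edge: "(edge_chain W x y :: 'a mono set \<Rightarrow>\<^sub>0 ('a, 'k) mpoly) \<in> scarf_module V I 2"
    if "{x, y} \<in> scarf_complex I" "x \<noteq> y" for x y
    unfolding edge_chain_def using that keys_diff_mono_subset[of W "mono_lcm {x, y}"] W(1)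
    by (intro single_in_scarf_module) auto
  have "?f \<in> scarf_module V I 2"
    using dist sc by (intro scarf_module_add edge) auto
  moreover have "taylor_diff ?f = 0"
    using dist W taylor_diff_edge_chain[of s p W, OF _ W(5,2)]
    by (auto simp: taylor_diff_add taylor_diff_edge_chain)
  ultimately obtain g where g: "g \<in> scarf_module V I 3" "?f = taylor_diff g"
    using scarf_resolution_exact[OF res, of 2 ?f] by (auto simp: numeral_3_eq_3 numeral_2_eq_2)
  have fing: "finite \<sigma>" if "\<sigma> \<in> keys g" for \<sigma>
    using scarf_moduleD[OF g(1) that] by (auto intro: card_ge_0_finite)
  have "strand W g \<sigma> = 0" if "\<sigma> \<in> keys g" for \<sigma>
    using scarf_moduleD[OF g(1) that] * by (auto simp: strand_def)
  then have "strand W ?f {p, q} = 0"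
    unfolding g(2) by (subst strand_taylor_diff) (auto intro!: sum.neutral fing)
  moreover have st: "strand W (edge_chain W x y) {p, q} = (if {x, y} = {p, q} then (- 1) ^ mono_pos {x, y} x else 0)"
    if "mono_dvd x W" "mono_dvd y W" for x y
    unfolding edge_chain_def using that by (intro strand_single) (simp add: mono_lcm_dvd_iff)
  have "strand W ?f {p, q} = (- 1) ^ mono_pos {p, q} p"
  proof -
    have "{q, r} \<noteq> {p, q}" "{r, s} \<noteq> {p, q}" "{s, p} \<noteq> {p, q}"
      using dist by (auto simp: doubleton_eq_iff)
    then have "strand W (edge_chain W q r :: 'a mono set \<Rightarrow>\<^sub>0 ('a, 'k) mpoly) {p, q} = 0"
      "strand W (edge_chain W r s :: 'a mono set \<Rightarrow>\<^sub>0 ('a, 'k) mpoly) {p, q} = 0"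
      "strand W (edge_chain W s p :: 'a mono set \<Rightarrow>\<^sub>0 ('a, 'k) mpoly) {p, q} = 0"
      by (simp_all only: st[OF W(3,4)] st[OF W(4,5)] st[OF W(5,2)] if_False)
    then show ?thesis by (simp add: strand_add st[OF W(2,3)])
  qed
  ultimately have "(- 1 :: 'k) ^ mono_pos {p, q} p = 0" by simp
  \<comment> \<open>A sign is its own inverse, so this product is 1.\<close>
  then have "(- 1 :: 'k) ^ mono_pos {p, q} p * (- 1) ^ mono_pos {p, q} p = 0" by simp
  then show False by (simp flip: power_add)
qed

section \<open>Exactness of the Taylor complex\<close>

lemma finite_has_mono_order_min:
  assumes "finite A" "A \<noteq> {}"
  shows "\<exists>a\<in>A. \<forall>b\<in>A. b \<noteq> a \<longrightarrow> (a, b) \<in> mono_order"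
  using assms
proof (induction A rule: finite_ne_induct)
  case (insert x F)
  then obtain a where a: "a \<in> F" "\<forall>b\<in>F. b \<noteq> a \<longrightarrow> (a, b) \<in> mono_order" by blast
  show ?case
  proof (cases "(a, x) \<in> mono_order")
    case True
    then show ?thesis using a by blast
  next
    case False
    then have "(x, a) \<in> mono_order" using mono_order_cases[of a x] a insert.hyps by blast
    then have "(x, b) \<in> mono_order" if "b \<in> F" for b
      using a(2) that mono_order_trans[of x a b] by (cases "b = a") auto
    then show ?thesis by blast
  qed
qed simp

text \<open>The apex of the contraction in multidegree \<open>W\<close>. It has to depend on
  \<open>W\<close>, as a generator dividing one multidegree need not divide another.\<close>

definition cone_gen :: "'a mono set \<Rightarrow> 'a mono \<Rightarrow> 'a mono" where
  "cone_gen G W = (SOME a. a \<in> G \<and> mono_dvd a W \<and>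
     (\<forall>b\<in>G. mono_dvd b W \<and> b \<noteq> a \<longrightarrow> (a, b) \<in> mono_order))"

lemma cone_gen:
  assumes "finite G" "\<exists>a\<in>G. mono_dvd a W"
  shows "cone_gen G W \<in> G" "mono_dvd (cone_gen G W) W"
    "\<And>b. b \<in> G \<Longrightarrow> mono_dvd b W \<Longrightarrow> b \<noteq> cone_gen G W \<Longrightarrow> (cone_gen G W, b) \<in> mono_order"
proof -
  have "\<exists>a. a \<in> G \<and> mono_dvd a W \<and> (\<forall>b\<in>G. mono_dvd b W \<and> b \<noteq> a \<longrightarrow> (a, b) \<in> mono_order)"
    using finite_has_mono_order_min[of "{a\<in>G. mono_dvd a W}"] assms by auto
  from someI_ex[OF this, folded cone_gen_def] show "cone_gen G W \<in> G" "mono_dvd (cone_gen G W) W"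
    "\<And>b. b \<in> G \<Longrightarrow> mono_dvd b W \<Longrightarrow> b \<noteq> cone_gen G W \<Longrightarrow> (cone_gen G W, b) \<in> mono_order" by auto
qed

text \<open>The multiple of the basis element \<sigma> that lies in multidegree \<open>W\<close>.
  This reading is valid only if the lcm of \<sigma> divides \<open>W\<close>, as the difference is
  truncated.\<close>

definition hterm :: "'a mono \<Rightarrow> 'a mono set \<Rightarrow> 'k \<Rightarrow> ('a mono set \<Rightarrow>\<^sub>0 ('a, 'k::comm_ring_1) mpoly)" where
  "hterm W \<sigma> c = Poly_Mapping.single \<sigma> (Poly_Mapping.single (W - mono_lcm \<sigma>) c)"

lemma hterm_add: "hterm W \<sigma> (c + d) = hterm W \<sigma> c + hterm W \<sigma> d"
  by (simp add: hterm_def single_add)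

lemma hterm_0 [simp]: "hterm W \<sigma> 0 = 0"
  by (simp add: hterm_def)

lemma hterm_minus: "hterm W \<sigma> (- c) = - hterm W \<sigma> c"
  by (simp add: hterm_def single_uminus)

lemma taylor_diff_hterm:
  assumes "finite \<sigma>" "mono_dvd (mono_lcm \<sigma>) W"
  shows "taylor_diff (hterm W \<sigma> c) = (\<Sum>m\<in>\<sigma>. hterm W (\<sigma> - {m}) ((- 1) ^ mono_pos \<sigma> m * c))"
  unfolding hterm_def taylor_diff_single
proof (intro sum.cong refl)
  fix m assume "m \<in> \<sigma>"
  have "W - mono_lcm \<sigma> + (mono_lcm \<sigma> - mono_lcm (\<sigma> - {m})) = W - mono_lcm (\<sigma> - {m})"
    by (rule mono_diff_diff_add) (use assms in \<open>auto intro: mono_lcm_mono\<close>)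
  then show "Poly_Mapping.single (\<sigma> - {m}) (Poly_Mapping.single (W - mono_lcm \<sigma>) c * taylor_coeff \<sigma> m) =
      Poly_Mapping.single (\<sigma> - {m}) (Poly_Mapping.single (W - mono_lcm (\<sigma> - {m})) ((- 1) ^ mono_pos \<sigma> m * c))"
    by (simp add: taylor_coeff_eq mult_single mult.commute)
qed

text \<open>The monomial \<open>u\<close> at \<sigma> belongs to multidegree
  \<open>u + mono_lcm \<sigma>\<close>. This multigraded decomposition lets identities of additive
  maps be checked on single homogeneous terms.\<close>

lemma chain_eq_sum_hterms:
  "f = (\<Sum>\<sigma>\<in>keys f. \<Sum>u\<in>keys (lookup f \<sigma>). hterm (u + mono_lcm \<sigma>) \<sigma> (lookup (lookup f \<sigma>) u))"
proof -
  have *: "Poly_Mapping.single \<sigma> (lookup f \<sigma>) = (\<Sum>u\<in>keys (lookup f \<sigma>). hterm (u + mono_lcm \<sigma>) \<sigma> (lookup (lookup f \<sigma>) u))" for \<sigma>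
  proof -
    have "Poly_Mapping.single \<sigma> (sum p A) = (\<Sum>u\<in>A. Poly_Mapping.single \<sigma> (p u :: ('a, 'b) mpoly))" for p and A :: "'a mono set"
      by (induction A rule: infinite_finite_induct) (simp_all add: single_add)
    then show ?thesis
      by (subst (1) poly_mapping_sum_single[of "lookup f \<sigma>"]) (simp add: hterm_def)
  qed
  show ?thesis
    by (subst (1) poly_mapping_sum_single[of f]) (simp only: *)
qed

lemma mono_pos_remove:
  assumes "finite \<sigma>" "m \<in> \<sigma>" "m \<noteq> m'"
  shows "mono_pos \<sigma> m' = (if (m, m') \<in> mono_order then Suc (mono_pos (\<sigma> - {m}) m') else mono_pos (\<sigma> - {m}) m')"
proof -
  let ?A = "{b \<in> \<sigma> - {m}. b \<noteq> m' \<and> (b, m') \<in> mono_order}"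
  have "{b\<in>\<sigma>. b \<noteq> m' \<and> (b, m') \<in> mono_order} = (if (m, m') \<in> mono_order then insert m ?A else ?A)"
    using assms by auto
  then show ?thesis using assms(1) by (simp add: mono_pos_def)
qed

text \<open>Swapping the summation variables alone would show only that twice the sum vanishes,
  which says nothing in characteristic 2. Hence the pairs are split by the order, and the two halves
  cancel.\<close>

lemma sum_antisymmetric_eq_0:
  fixes F :: "'b mono \<Rightarrow> 'b mono \<Rightarrow> 'c::ab_group_add"
  assumes "finite A" "\<And>x y. x \<in> A \<Longrightarrow> y \<in> A \<Longrightarrow> x \<noteq> y \<Longrightarrow> F y x = - F x y"
  shows "(\<Sum>x\<in>A. \<Sum>y\<in>A - {x}. F x y) = 0"
proof -
  let ?P = "{(x, y). x \<in> A \<and> y \<in> A \<and> x \<noteq> y \<and> (x, y) \<in> mono_order}"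
  let ?Q = "{(x, y). x \<in> A \<and> y \<in> A \<and> x \<noteq> y \<and> (y, x) \<in> mono_order}"
  have fin: "finite ?P" "finite ?Q"
    by (rule finite_subset[of _ "A \<times> A"], use assms(1) in auto)+
  have "(\<Sum>x\<in>A. \<Sum>y\<in>A - {x}. F x y) = (\<Sum>(x, y)\<in>Sigma A (\<lambda>x. A - {x}). F x y)"
    using assms(1) by (simp add: sum.Sigma)
  also have "Sigma A (\<lambda>x. A - {x}) = ?P \<union> ?Q"
    using mono_order_cases by auto
  also have "(\<Sum>(x, y)\<in>?P \<union> ?Q. F x y) = (\<Sum>(x, y)\<in>?P. F x y) + (\<Sum>(x, y)\<in>?Q. F x y)"
    using mono_order_cases by (intro sum.union_disjoint fin) auto
  also have "(\<Sum>(x, y)\<in>?Q. F x y) = (\<Sum>(x, y)\<in>?P. F y x)"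
    by (rule sum.reindex_bij_witness[of _ "\<lambda>(x, y). (y, x)" "\<lambda>(x, y). (y, x)"]) auto
  also have "\<dots> = (\<Sum>(x, y)\<in>?P. - F x y)"
    using assms(2) by (intro sum.cong) auto
  also have "\<dots> = - (\<Sum>(x, y)\<in>?P. F x y)"
    by (simp add: sum_negf case_prod_unfold)
  finally show ?thesis by simp
qed

text \<open>Removing two elements in either order leaves the same face. Removing the earlier one
  first lowers the position of the later one by 1, whereas the other order shifts nothing, so the
  signs are opposite.\<close>

lemma taylor_diff_taylor_diff_hterm:
  assumes "finite \<sigma>" "mono_dvd (mono_lcm \<sigma>) W"
  shows "taylor_diff (taylor_diff (hterm W \<sigma> c)) = (0 :: 'a mono set \<Rightarrow>\<^sub>0 ('a, 'k::comm_ring_1) mpoly)"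
proof -
  define F where "F = (\<lambda>m m'. hterm W (\<sigma> - {m} - {m'}) ((- 1) ^ mono_pos (\<sigma> - {m}) m' * ((- 1) ^ mono_pos \<sigma> m * c)))"
  have "taylor_diff (hterm W (\<sigma> - {m}) ((- 1) ^ mono_pos \<sigma> m * c)) = (\<Sum>m'\<in>\<sigma> - {m}. F m m')" for m
    unfolding F_def
    by (rule taylor_diff_hterm) (use assms mono_lcm_mono[of \<sigma> "\<sigma> - {m}"] mono_dvd_trans in auto)
  then have "taylor_diff (taylor_diff (hterm W \<sigma> c)) = (\<Sum>m\<in>\<sigma>. \<Sum>m'\<in>\<sigma> - {m}. F m m')"
    by (simp add: taylor_diff_hterm[OF assms] taylor_diff_sum)
  also have "\<dots> = 0"
  proof (rule sum_antisymmetric_eq_0[OF assms(1)])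
    fix m m' assume m: "m \<in> \<sigma>" "m' \<in> \<sigma>" "m \<noteq> m'"
    have s: "\<sigma> - {m'} - {m} = \<sigma> - {m} - {m'}" by blast
    have "(- 1 :: 'k) ^ mono_pos (\<sigma> - {m'}) m * ((- 1) ^ mono_pos \<sigma> m' * c)
        = - ((- 1) ^ mono_pos (\<sigma> - {m}) m' * ((- 1) ^ mono_pos \<sigma> m * c))"
      using mono_order_cases[OF m(3)] mono_pos_remove[OF assms(1) m(1,3)] mono_pos_remove[OF assms(1) m(2)] m(3)
      by (cases "(m, m') \<in> mono_order") (auto simp: algebra_simps)
    then show "F m' m = - F m m'"
      unfolding F_def s hterm_minus[symmetric] by simp
  qed
  finally show ?thesis .
qed

lemma taylor_diff_taylor_diff:
  assumes "\<And>\<sigma>. \<sigma> \<in> keys f \<Longrightarrow> finite \<sigma>"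
  shows "taylor_diff (taylor_diff f) = 0"
  by (subst chain_eq_sum_hterms[of f], simp only: taylor_diff_sum)
    (intro sum.neutral ballI taylor_diff_taylor_diff_hterm assms; simp)

text \<open>In each multidegree \<open>W\<close> the complex is a full simplex; it is contracted to the
  order-minimal generator dividing \<open>W\<close>, which comes first in every face and hence creates
  no signs.\<close>

definition cone_term :: "'a mono set \<Rightarrow> 'a mono \<Rightarrow> 'a mono set \<Rightarrow> 'k \<Rightarrow> ('a mono set \<Rightarrow>\<^sub>0 ('a, 'k::comm_ring_1) mpoly)" where
  "cone_term G W \<sigma> c = (if cone_gen G W \<in> \<sigma> then 0 else hterm W (insert (cone_gen G W) \<sigma>) c)"

definition cone :: "'a mono set \<Rightarrow> ('a mono set \<Rightarrow>\<^sub>0 ('a, 'k::comm_ring_1) mpoly) \<Rightarrow> ('a mono set \<Rightarrow>\<^sub>0 ('a, 'k) mpoly)" where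
  "cone G f = (\<Sum>\<sigma>\<in>keys f. \<Sum>u\<in>keys (lookup f \<sigma>). cone_term G (u + mono_lcm \<sigma>) \<sigma> (lookup (lookup f \<sigma>) u))"

lemma cone_term_add: "cone_term G W \<sigma> (c + d) = cone_term G W \<sigma> c + cone_term G W \<sigma> d"
  by (simp add: cone_term_def hterm_add)

lemma cone_term_0 [simp]: "cone_term G W \<sigma> 0 = 0"
  by (simp add: cone_term_def)

lemma cone_add: "cone G (f + g) = cone G f + cone G g"
  unfolding cone_def
proof (rule setsum_keys_plus_distrib)
  show "(\<Sum>u\<in>keys (lookup f k + lookup g k). cone_term G (u + mono_lcm k) k (lookup (lookup f k + lookup g k) u))
    = (\<Sum>u\<in>keys (lookup f k). cone_term G (u + mono_lcm k) k (lookup (lookup f k) u))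
      + (\<Sum>u\<in>keys (lookup g k). cone_term G (u + mono_lcm k) k (lookup (lookup g k) u))" for k
    by (rule setsum_keys_plus_distrib) (simp_all add: cone_term_add)
qed simp

lemma cone_0 [simp]: "cone G 0 = 0"
  by (simp add: cone_def)

lemma cone_sum: "cone G (sum f A) = (\<Sum>i\<in>A. cone G (f i))"
  by (induction A rule: infinite_finite_induct) (simp_all add: cone_add)

lemma cone_hterm:
  assumes "mono_dvd (mono_lcm \<sigma>) W"
  shows "cone G (hterm W \<sigma> c) = cone_term G W \<sigma> c"
proof (cases "c = 0")
  case False
  then have "keys (Poly_Mapping.single (W - mono_lcm \<sigma>) c) \<noteq> {}" by simp
  then have "Poly_Mapping.single (W - mono_lcm \<sigma>) c \<noteq> 0" by (metis keys_zero)
  then show ?thesis using False mono_diff_add_cancel[OF assms] by (simp add: cone_def hterm_def)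
qed simp

text \<open>If \<sigma> contains the apex, its cone vanishes, and the only face with nonzero cone is
  the one opposite to the apex, whose cone is \<sigma>. Otherwise the boundary of the cone over
  \<sigma> is \<sigma> minus the cone over the boundary of \<sigma>.\<close>

lemma cone_homotopy_hterm:
  fixes c :: "'k::comm_ring_1"
  assumes G: "finite G" "\<exists>a\<in>G. mono_dvd a W" and \<sigma>: "\<sigma> \<subseteq> G" "mono_dvd (mono_lcm \<sigma>) W"
  shows "taylor_diff (cone G (hterm W \<sigma> c)) + cone G (taylor_diff (hterm W \<sigma> c)) = hterm W \<sigma> c"
proof -
  let ?a = "cone_gen G W"
  note a = cone_gen[OF G]
  have fin: "finite \<sigma>" using \<sigma>(1) G(1) finite_subset by blast
  have dvd: "mono_dvd m W" if "m \<in> \<sigma>" for m using \<sigma>(2) that mono_lcm_dvd_iff[OF fin] by blast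
  have sub: "mono_dvd (mono_lcm (\<sigma> - {m})) W" for m
    using \<sigma>(2) mono_lcm_mono[OF fin, of "\<sigma> - {m}"] mono_dvd_trans by blast
  have pos: "mono_pos \<tau> ?a = 0" if "\<tau> \<subseteq> insert ?a \<sigma>" for \<tau>
  proof -
    have "{m \<in> \<tau>. m \<noteq> ?a \<and> (m, ?a) \<in> mono_order} = {}"
      using a(3) dvd that \<sigma>(1) mono_order_cases by blast
    then show ?thesis unfolding mono_pos_def by (simp only: card.empty)
  qed
  have R: "cone G (taylor_diff (hterm W \<sigma> c)) = (\<Sum>m\<in>\<sigma>. cone_term G W (\<sigma> - {m}) ((- 1) ^ mono_pos \<sigma> m * c))"
    by (simp add: taylor_diff_hterm[OF fin \<sigma>(2)] cone_sum cone_hterm[OF sub])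
  show ?thesis
  proof (cases "?a \<in> \<sigma>")
    case True
    have "cone_term G W (\<sigma> - {m}) ((- 1) ^ mono_pos \<sigma> m * c) = (if m = ?a then hterm W \<sigma> c else 0)" if "m \<in> \<sigma>" for m
      using True pos[of \<sigma>] by (auto simp: cone_term_def insert_absorb)
    then have "cone G (taylor_diff (hterm W \<sigma> c)) = (\<Sum>m\<in>\<sigma>. if m = ?a then hterm W \<sigma> c else 0)"
      unfolding R by (rule sum.cong[OF refl])
    then show ?thesis using True fin by (simp add: cone_hterm[OF \<sigma>(2)] cone_term_def)
  next
    case False
    let ?\<tau> = "insert ?a \<sigma>"
    have \<tau>: "finite ?\<tau>" "mono_dvd (mono_lcm ?\<tau>) W" using fin dvd a(2) by (auto simp: mono_lcm_dvd_iff)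
    have "hterm W (?\<tau> - {m}) ((- 1) ^ mono_pos ?\<tau> m * c) = - cone_term G W (\<sigma> - {m}) ((- 1) ^ mono_pos \<sigma> m * c)"
      if m: "m \<in> \<sigma>" for m
    proof -
      have ne: "?a \<noteq> m" using False m by auto
      have "(?a, m) \<in> mono_order" using a(3)[of m] m \<sigma>(1) dvd ne by blast
      \<comment> \<open>The apex precedes every element of \<sigma>, so all other positions rise by
        1 and all signs change.\<close>
      then have "mono_pos ?\<tau> m = Suc (mono_pos \<sigma> m)"
        using mono_pos_remove[OF \<tau>(1), of ?a m] ne False by simp
      moreover have "?\<tau> - {m} = insert ?a (\<sigma> - {m})" using ne by auto
      ultimately show ?thesis using False by (simp add: cone_term_def hterm_minus)
    qed
    then have "(\<Sum>m\<in>\<sigma>. hterm W (?\<tau> - {m}) ((- 1) ^ mono_pos ?\<tau> m * c)) = - cone G (taylor_diff (hterm W \<sigma> c))"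
      unfolding R sum_negf[symmetric] by (rule sum.cong[OF refl])
    moreover have "?\<tau> - {?a} = \<sigma>" using False by simp
    ultimately have "taylor_diff (hterm W ?\<tau> c) = hterm W \<sigma> c - cone G (taylor_diff (hterm W \<sigma> c))"
      unfolding taylor_diff_hterm[OF \<tau>] using fin False pos[of ?\<tau>] by simp
    then show ?thesis using False by (simp add: cone_hterm[OF \<sigma>(2)] cone_term_def)
  qed
qed

text \<open>The condition \<open>dvd\<close> is automatic in positive homological degree, where any
  element of \<sigma> serves. In degree 0 it says that every monomial of the coefficient is a
  multiple of a generator, which is just where exactness has to stop.\<close>

lemma cone_homotopy:
  assumes G: "finite G" and f: "\<And>\<sigma>. \<sigma> \<in> keys f \<Longrightarrow> \<sigma> \<subseteq> G"
    and dvd: "\<And>\<sigma> u. \<sigma> \<in> keys f \<Longrightarrow> u \<in> keys (lookup f \<sigma>) \<Longrightarrow> \<exists>a\<in>G. mono_dvd a (u + mono_lcm \<sigma>)"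
  shows "taylor_diff (cone G f) + cone G (taylor_diff f) = f"
proof -
  let ?t = "\<lambda>\<sigma> u. hterm (u + mono_lcm \<sigma>) \<sigma> (lookup (lookup f \<sigma>) u)"
  have "taylor_diff (cone G f) + cone G (taylor_diff f)
     = (\<Sum>\<sigma>\<in>keys f. \<Sum>u\<in>keys (lookup f \<sigma>). taylor_diff (cone G (?t \<sigma> u)) + cone G (taylor_diff (?t \<sigma> u)))"
    by (subst (1 2) chain_eq_sum_hterms[of f]) (simp only: taylor_diff_sum cone_sum sum.distrib)
  also have "\<dots> = (\<Sum>\<sigma>\<in>keys f. \<Sum>u\<in>keys (lookup f \<sigma>). ?t \<sigma> u)"
    by (intro sum.cong refl cone_homotopy_hterm G dvd f) simp_all
  also have "\<dots> = f" by (rule chain_eq_sum_hterms[symmetric])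
  finally show ?thesis .
qed

section \<open>Resolution and minimality when all lcms are distinct\<close>

lemma scarf_module_sum:
  assumes "\<And>i. i \<in> A \<Longrightarrow> f i \<in> scarf_module V I k"
  shows "sum f A \<in> scarf_module V I k"
  using assms
  by (induction A rule: infinite_finite_induct)
    (auto intro: scarf_module_add, simp_all add: scarf_module_def free_module_def in_carrier_poly_ring)

lemma hterm_in_scarf_module:
  assumes "\<sigma> \<in> scarf_complex I" "card \<sigma> = i" "keys W \<subseteq> V"
  shows "hterm W \<sigma> c \<in> scarf_module V I i"
  unfolding hterm_def using assms keys_diff_mono_subset[of W "mono_lcm \<sigma>"]
  by (intro single_in_scarf_module) auto

text \<open>In a Scarf face the removal of any element changes the lcm, because the smaller set is
  another set of generators. So every Taylor coefficient on a Scarf face is divisible by a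
  variable.\<close>

lemma scarf_minimal:
  fixes I :: "('a, 'k::comm_ring_1) mpoly set"
  assumes "finite (mingens I)" "\<And>m. m \<in> mingens I \<Longrightarrow> keys m \<subseteq> V"
  shows "scarf_is_minimal V I"
proof -
  let ?J = "mono_ideal V ((\<lambda>v. Poly_Mapping.single v 1) ` V) :: ('a, 'k) mpoly set"
  have "var ` V = (monom ` (\<lambda>v. Poly_Mapping.single v 1) ` V :: ('a, 'k) mpoly set)"
    by (simp only: image_image)
  moreover have "Idl\<^bsub>poly_ring V\<^esub> (monom ` (\<lambda>v. Poly_Mapping.single v 1) ` V) = ?J"
    by (rule genideal_monom) auto
  ultimately have J: "Idl\<^bsub>poly_ring V\<^esub> (var ` V) = ?J" by (simp only:)
  have id: "ideal ?J (poly_ring V)" by (rule ideal_mono_ideal)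
  have "lookup (taylor_diff f) \<tau> \<in> ?J" if f: "f \<in> scarf_module V I (Suc i)" for f \<tau> i
    unfolding lookup_taylor_diff
  proof (intro ideal_sum_closed[OF id])
    fix \<sigma> m assume \<sigma>: "\<sigma> \<in> keys f" "m \<in> \<sigma>"
    have sc: "\<sigma> \<in> scarf_complex I" using scarf_moduleD[OF f \<sigma>(1)] by blast
    then have sub: "\<sigma> \<subseteq> mingens I" by (auto simp: scarf_complex_def)
    have fin: "finite \<sigma>" using sub assms(1) finite_subset by blast
    let ?t = "mono_lcm \<sigma> - mono_lcm (\<sigma> - {m})"
    have "mono_lcm \<sigma> \<noteq> mono_lcm (\<sigma> - {m})"
    proof -
      have "\<sigma> - {m} \<subseteq> mingens I" "\<sigma> - {m} \<noteq> \<sigma>" using \<sigma>(2) sub by auto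
      then show ?thesis using sc unfolding scarf_complex_def mem_Collect_eq by metis
    qed
    then have "?t \<noteq> 0"
      using mono_diff_add_cancel[OF mono_lcm_mono[OF fin, of "\<sigma> - {m}"]] by fastforce
    then obtain v where v: "v \<in> keys ?t" by (metis keys_eq_empty ex_in_conv)
    have tV: "keys ?t \<subseteq> V"
    proof (rule order_trans[OF keys_diff_mono_subset], rule keys_mono_lcm_subset[OF fin])
      show "keys m \<subseteq> V" if "m \<in> \<sigma>" for m using that sub assms(2) by blast
    qed
    have "mono_dvd (Poly_Mapping.single v 1) ?t"
      using v by (auto simp: mono_dvd_def lookup_single when_def in_keys_iff Suc_le_eq)
    then have "taylor_coeff \<sigma> m \<in> ?J"
      using v tV by (auto simp: taylor_coeff_eq mono_ideal_def in_carrier_poly_ring split: if_splits)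
    moreover have "lookup f \<sigma> \<in> carrier (poly_ring V)"
      using f by (simp add: scarf_module_def free_module_def)
    ultimately have "lookup f \<sigma> * taylor_coeff \<sigma> m \<in> ?J"
      using ideal.I_l_closed[OF id] by fastforce
    moreover have "0 \<in> ?J" by (simp add: mono_ideal_def in_carrier_poly_ring)
    ultimately show "(if \<sigma> - {m} = \<tau> then lookup f \<sigma> * taylor_coeff \<sigma> m else 0) \<in> ?J" by simp
  qed
  then show ?thesis unfolding scarf_is_minimal_def J by blast
qed

text \<open>One contraction serves exactness at every place, since it works on all terms whose
  multidegree is divisible by a generator.\<close>

lemma scarf_ideal_if_lcm_inj:
  fixes V :: "'a set" and G :: "'a mono set"
  assumes fin: "finite G" and GV: "\<And>a. a \<in> G \<Longrightarrow> keys a \<subseteq> V" and inj: "inj_on mono_lcm (Pow G)"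
  shows "scarf_ideal V (mono_ideal V G :: ('a, 'k::comm_ring_1) mpoly set)"
proof -
  let ?I = "mono_ideal V G :: ('a, 'k) mpoly set"
  let ?R = "poly_ring V :: ('a, 'k) mpoly ring"
  interpret cring ?R by (rule cring_poly_ring)
  interpret I: ideal ?I ?R by (rule ideal_mono_ideal)
  \<comment> \<open>If \<open>a\<close> divided \<open>b\<close>, the sets \<open>{a, b}\<close> and
    \<open>{b}\<close> would have the same lcm. So injectivity already makes \<open>G\<close> an
    antichain.\<close>
  have anti: "a = b" if ab: "a \<in> G" "b \<in> G" "mono_dvd a b" for a b
  proof -
    have "mono_dvd b (mono_lcm {a, b})" by (rule mono_dvd_lcm) auto
    then have "mono_lcm {a, b} = mono_lcm {b}"
      using ab(3) by (intro mono_dvd_antisym) (auto simp: mono_lcm_dvd_iff)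
    then have "{a, b} = {b}" using inj_onD[OF inj, of "{a, b}" "{b}"] ab by blast
    then show ?thesis by blast
  qed
  have mg: "mingens ?I = G" by (rule mingens_mono_ideal[OF GV anti])
  have sc: "scarf_complex ?I = Pow G"
  proof (intro equalityI subsetI)
    fix \<sigma> assume \<sigma>: "\<sigma> \<in> Pow G"
    have "mono_lcm \<sigma> \<noteq> mono_lcm \<tau>" if "\<tau> \<subseteq> G" "\<tau> \<noteq> \<sigma>" for \<tau>
      using inj_onD[OF inj, of \<sigma> \<tau>] \<sigma> that by blast
    then show "\<sigma> \<in> scarf_complex ?I" using \<sigma> by (simp add: scarf_complex_def mg)
  qed (simp add: scarf_complex_def mg)
  have lcmV: "keys (mono_lcm \<sigma>) \<subseteq> V" if "\<sigma> \<subseteq> G" for \<sigma>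
  proof (rule keys_mono_lcm_subset)
    show "finite \<sigma>" using that fin finite_subset by blast
    show "keys m \<subseteq> V" if "m \<in> \<sigma>" for m using that \<open>\<sigma> \<subseteq> G\<close> GV by blast
  qed
  have modD: "\<sigma> \<subseteq> G" "finite \<sigma>" "card \<sigma> = i" if "f \<in> scarf_module V ?I i" "\<sigma> \<in> keys f" for f \<sigma> i
  proof -
    show "\<sigma> \<subseteq> G" "card \<sigma> = i" using scarf_moduleD[OF that] by (simp_all add: sc)
    then show "finite \<sigma>" using fin finite_subset by blast
  qed
  have carr: "lookup f \<sigma> \<in> carrier ?R" if "f \<in> scarf_module V ?I i" for f \<sigma> i
    using that by (simp add: scarf_module_def free_module_def)
  have WV: "keys (u + mono_lcm \<sigma>) \<subseteq> V"
    if "f \<in> scarf_module V ?I i" "\<sigma> \<in> keys f" "u \<in> keys (lookup f \<sigma>)" for f \<sigma> u i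
    using carr[OF that(1), of \<sigma>] that(3) lcmV[OF modD(1)[OF that(1,2)]]
    by (auto simp: in_carrier_poly_ring keys_add_mono)
  have diff: "taylor_diff f \<in> scarf_module V ?I i" if f: "f \<in> scarf_module V ?I (Suc i)" for f i
  proof (subst chain_eq_sum_hterms[of f], unfold taylor_diff_sum, intro scarf_module_sum)
    fix \<sigma> u assume u: "\<sigma> \<in> keys f" "u \<in> keys (lookup f \<sigma>)"
    note \<sigma> = modD[OF f u(1)]
    show "taylor_diff (hterm (u + mono_lcm \<sigma>) \<sigma> (lookup (lookup f \<sigma>) u)) \<in> scarf_module V ?I i"
      unfolding taylor_diff_hterm[OF \<sigma>(2) mono_dvd_addI(1)]
      by (intro scarf_module_sum hterm_in_scarf_module WV[OF f u]) (use \<sigma> in \<open>auto simp: sc\<close>)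
  qed
  have cone: "cone G f \<in> scarf_module V ?I (Suc i)"
    if f: "f \<in> scarf_module V ?I i"
      and dvd: "\<And>\<sigma> u. \<sigma> \<in> keys f \<Longrightarrow> u \<in> keys (lookup f \<sigma>) \<Longrightarrow> \<exists>a\<in>G. mono_dvd a (u + mono_lcm \<sigma>)" for f i
    unfolding cone_def
  proof (intro scarf_module_sum)
    fix \<sigma> u assume u: "\<sigma> \<in> keys f" "u \<in> keys (lookup f \<sigma>)"
    note \<sigma> = modD[OF f u(1)]
    note a = cone_gen[OF fin dvd[OF u]]
    have "(0 :: 'a mono set \<Rightarrow>\<^sub>0 ('a, 'k) mpoly) \<in> scarf_module V ?I (Suc i)"
      using scarf_module_sum[of "{}"] by simp
    then show "cone_term G (u + mono_lcm \<sigma>) \<sigma> (lookup (lookup f \<sigma>) u) \<in> scarf_module V ?I (Suc i)"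
      unfolding cone_term_def using a(1) \<sigma> WV[OF f u]
      by (auto intro!: hterm_in_scarf_module simp: sc)
  qed
  have exact: "f \<in> taylor_diff ` scarf_module V ?I (Suc i)"
    if f: "f \<in> scarf_module V ?I i" "taylor_diff f = 0"
      and dvd: "\<And>\<sigma> u. \<sigma> \<in> keys f \<Longrightarrow> u \<in> keys (lookup f \<sigma>) \<Longrightarrow> \<exists>a\<in>G. mono_dvd a (u + mono_lcm \<sigma>)" for f i
  proof (rule image_eqI)
    show "f = taylor_diff (cone G f)"
      using cone_homotopy[of G f, OF fin modD(1)[OF f(1)] dvd] f(2) by simp
    show "cone G f \<in> scarf_module V ?I (Suc i)" by (rule cone[OF f(1) dvd])
  qed
  have aug: "augmentation V ?I f = \<zero>\<^bsub>?R Quot ?I\<^esub> \<longleftrightarrow> lookup f {} \<in> ?I" if f: "f \<in> scarf_module V ?I i" for f i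
  proof -
    have "augmentation V ?I f = \<zero>\<^bsub>?R Quot ?I\<^esub> \<longleftrightarrow> ?I +>\<^bsub>?R\<^esub> lookup f {} = ?I"
      by (simp only: augmentation_def FactRing_def ring_record_simps)
    then show ?thesis
      using a_rcos_zero[OF I.is_ideal, of "lookup f {}"] I.rcos_const_imp_mem[OF carr[OF f, of "{}"]] by blast
  qed
  have 1: "augmentation V ?I ` scarf_module V ?I 0 = carrier (?R Quot ?I)"
  proof (intro equalityI subsetI)
    fix X assume "X \<in> augmentation V ?I ` scarf_module V ?I 0"
    then show "X \<in> carrier (?R Quot ?I)"
      using carr by (auto simp: augmentation_def FactRing_def A_RCOSETS_def')
  next
    fix X assume "X \<in> carrier (?R Quot ?I)"
    then obtain p where p: "p \<in> carrier ?R" "X = ?I +>\<^bsub>?R\<^esub> p"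
      by (auto simp: FactRing_def A_RCOSETS_def')
    have "Poly_Mapping.single {} p \<in> scarf_module V ?I 0"
      using p(1) by (auto simp: scarf_module_def free_module_def sc lookup_single when_def in_carrier_poly_ring)
    moreover have "augmentation V ?I (Poly_Mapping.single {} p) = X"
      by (simp add: augmentation_def p(2))
    ultimately show "X \<in> augmentation V ?I ` scarf_module V ?I 0" by blast
  qed
  have 2: "{f \<in> scarf_module V ?I 0. augmentation V ?I f = \<zero>\<^bsub>?R Quot ?I\<^esub>} = taylor_diff ` scarf_module V ?I 1"
  proof (intro equalityI subsetI)
    fix f assume "f \<in> {f \<in> scarf_module V ?I 0. augmentation V ?I f = \<zero>\<^bsub>?R Quot ?I\<^esub>}"
    then have f: "f \<in> scarf_module V ?I 0" "lookup f {} \<in> ?I" using aug by auto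
    have k: "\<sigma> = {}" if "\<sigma> \<in> keys f" for \<sigma> using modD[OF f(1) that] by simp
    \<comment> \<open>In degree 0 the differential is an empty sum, so the cycle condition is void;
      the augmentation condition supplies the divisibility instead.\<close>
    have "taylor_diff f = 0" unfolding taylor_diff_def using k by (intro sum.neutral) fastforce
    moreover have "\<exists>a\<in>G. mono_dvd a (u + mono_lcm \<sigma>)" if "\<sigma> \<in> keys f" "u \<in> keys (lookup f \<sigma>)" for \<sigma> u
    proof -
      have "\<sigma> = {}" by (rule k[OF that(1)])
      moreover have "\<exists>a\<in>G. mono_dvd a u" if "u \<in> keys (lookup f {})" for u
        using that f(2) unfolding mono_ideal_def by blast
      ultimately show ?thesis using that(2) by simp
    qed
    ultimately show "f \<in> taylor_diff ` scarf_module V ?I 1" using exact[OF f(1)] by simp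
  next
    fix f assume "f \<in> taylor_diff ` scarf_module V ?I 1"
    then obtain g where g: "g \<in> scarf_module V ?I 1" "f = taylor_diff g" by blast
    have f: "f \<in> scarf_module V ?I 0" using diff[of g 0] g by simp
    have "lookup f {} \<in> ?I"
      unfolding g(2) lookup_taylor_diff
    proof (intro ideal_sum_closed[OF I.is_ideal])
      fix \<sigma> m assume \<sigma>: "\<sigma> \<in> keys g" "m \<in> \<sigma>"
      have "lookup g \<sigma> * taylor_coeff \<sigma> m \<in> ?I" if "\<sigma> - {m} = {}"
      proof -
        have "\<sigma> = {m}" using that \<sigma>(2) by blast
        then have "taylor_coeff \<sigma> m \<in> ?I"
          using modD[OF g(1) \<sigma>(1)] GV
          by (auto simp: taylor_coeff_eq mono_ideal_def in_carrier_poly_ring intro: mono_dvd_refl split: if_splits)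
        then show ?thesis using I.I_l_closed carr[OF g(1), of \<sigma>] by fastforce
      qed
      then show "(if \<sigma> - {m} = {} then lookup g \<sigma> * taylor_coeff \<sigma> m else 0) \<in> ?I"
        by (auto simp: mono_ideal_def in_carrier_poly_ring)
    qed
    then show "f \<in> {f \<in> scarf_module V ?I 0. augmentation V ?I f = \<zero>\<^bsub>?R Quot ?I\<^esub>}" using f aug[OF f] by simp
  qed
  have 3: "{f \<in> scarf_module V ?I i. taylor_diff f = 0} = taylor_diff ` scarf_module V ?I (Suc i)" if i: "i \<ge> 1" for i
  proof (intro equalityI subsetI)
    fix f assume "f \<in> {f \<in> scarf_module V ?I i. taylor_diff f = 0}"
    then have f: "f \<in> scarf_module V ?I i" "taylor_diff f = 0" by auto
    have "\<exists>a\<in>G. mono_dvd a (u + mono_lcm \<sigma>)" if \<sigma>: "\<sigma> \<in> keys f" for \<sigma> u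
    proof -
      note D = modD[OF f(1) \<sigma>]
      have "\<sigma> \<noteq> {}" using D(3) i by auto
      then obtain a where a: "a \<in> \<sigma>" by blast
      have "mono_dvd a (u + mono_lcm \<sigma>)"
        by (rule mono_dvd_trans[OF mono_dvd_lcm[OF D(2) a] mono_dvd_addI(1)])
      then show ?thesis using a D(1) by blast
    qed
    then show "f \<in> taylor_diff ` scarf_module V ?I (Suc i)" using exact[OF f] by simp
  next
    fix f assume "f \<in> taylor_diff ` scarf_module V ?I (Suc i)"
    then obtain g where g: "g \<in> scarf_module V ?I (Suc i)" "f = taylor_diff g" by blast
    have "taylor_diff f = 0"
      unfolding g(2) by (rule taylor_diff_taylor_diff) (rule modD(2)[OF g(1)])
    then show "f \<in> {f \<in> scarf_module V ?I i. taylor_diff f = 0}" using diff[OF g(1)] g(2) by simp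
  qed
  have "scarf_is_resolution V ?I"
    unfolding scarf_is_resolution_def by (intro conjI allI impI 1 2 3)
  moreover have "scarf_is_minimal V ?I" by (rule scarf_minimal) (use mg fin GV in auto)
  ultimately show ?thesis by (simp add: scarf_ideal_def)
qed

section \<open>Scarf ideals of set families\<close>

lemma subset_image_set_mono:
  assumes "\<sigma> \<subseteq> set_mono ` B"
  obtains F where "F \<subseteq> B" "\<sigma> = set_mono ` F"
  using assms by (meson subset_imageE)

lemma inj_on_set_mono: "(\<And>S. S \<in> B \<Longrightarrow> finite S) \<Longrightarrow> inj_on set_mono B"
  by (rule inj_onI) (simp add: set_mono_inj)

definition scarf_pair :: "'a set set \<Rightarrow> 'a set \<Rightarrow> 'a set \<Rightarrow> bool" where
  "scarf_pair B P Q \<longleftrightarrow> P \<in> B \<and> Q \<in> B \<and> P \<noteq> Q \<and> (\<forall>R\<in>B. R \<subseteq> P \<union> Q \<longrightarrow> R = P \<or> R = Q)"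

text \<open>Adding \<open>T\<close> would give a different set of generators with the same lcm, so a
  Scarf face contains every generator that lies in its union.\<close>

lemma scarf_complex_set_mono:
  fixes I :: "('a, 'k::zero_neq_one) mpoly set"
  assumes mg: "mingens I = set_mono ` B" and B: "finite B" "\<And>S. S \<in> B \<Longrightarrow> finite S"
    and F: "F \<subseteq> B" "set_mono ` F \<in> scarf_complex I" and T: "T \<in> B" "T \<subseteq> \<Union>F"
  shows "T \<in> F"
proof (rule ccontr)
  assume "T \<notin> F"
  have "set_mono T \<notin> set_mono ` F"
    using \<open>T \<notin> F\<close> T(1) F(1) B(2) by (auto simp: set_mono_inj subset_iff)
  then have ne: "set_mono ` insert T F \<noteq> set_mono ` F" by blast
  have fin: "finite F" "\<And>S. S \<in> insert T F \<Longrightarrow> finite S"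
    using B F(1) T(1) by (auto intro: finite_subset)
  have "\<Union>(insert T F) = \<Union>F" using T(2) by blast
  then have "mono_lcm (set_mono ` insert T F) = mono_lcm (set_mono ` F)"
    using fin mono_lcm_set_mono[of F] mono_lcm_set_mono[of "insert T F"] by simp
  moreover have "set_mono ` insert T F \<subseteq> mingens I" using mg F(1) T(1) by auto
  ultimately show False using F(2) ne unfolding scarf_complex_def mem_Collect_eq by metis
qed

text \<open>A family with union \<open>P \<union> Q\<close> consists of \<open>P\<close> and
  \<open>Q\<close> only, by the condition on third members. That it contains both needs the
  antichain: a single one of them cannot cover the other.\<close>

lemma scarf_pair_iff:
  fixes I :: "('a, 'k::zero_neq_one) mpoly set"
  assumes mg: "mingens I = set_mono ` B" and B: "finite B" "\<And>S. S \<in> B \<Longrightarrow> finite S"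
    and anti: "\<And>S T. S \<in> B \<Longrightarrow> T \<in> B \<Longrightarrow> S \<subseteq> T \<Longrightarrow> S = T"
    and PQ: "P \<in> B" "Q \<in> B" "P \<noteq> Q"
  shows "{set_mono P, set_mono Q} \<in> scarf_complex I \<longleftrightarrow> scarf_pair B P Q"
proof
  assume "{set_mono P, set_mono Q} \<in> scarf_complex I"
  then have "set_mono ` {P, Q} \<in> scarf_complex I" by simp
  from scarf_complex_set_mono[OF mg B _ this] show "scarf_pair B P Q"
    using PQ unfolding scarf_pair_def by auto
next
  assume sp: "scarf_pair B P Q"
  have "mono_lcm {set_mono P, set_mono Q} \<noteq> mono_lcm \<tau>"
    if \<tau>: "\<tau> \<subseteq> mingens I" "\<tau> \<noteq> {set_mono P, set_mono Q}" for \<tau>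
  proof
    assume eq: "mono_lcm {set_mono P, set_mono Q} = mono_lcm \<tau>"
    obtain F where F: "F \<subseteq> B" "\<tau> = set_mono ` F"
      using \<tau>(1) unfolding mg by (rule subset_image_set_mono)
    have fin: "finite F" using F(1) B(1) finite_subset by blast
    have finS: "finite S" if "S \<in> F" for S using F(1) B(2) that by blast
    have "mono_lcm (set_mono ` {P, Q}) = mono_lcm (set_mono ` F)" using eq F(2) by simp
    moreover have "mono_lcm (set_mono ` {P, Q}) = set_mono (\<Union>{P, Q})"
      by (rule mono_lcm_set_mono) (use B(2) PQ in auto)
    ultimately have "set_mono (\<Union>{P, Q}) = set_mono (\<Union>F)"
      using mono_lcm_set_mono[OF fin finS] by simp
    moreover have "finite (\<Union>{P, Q})" "finite (\<Union>F)" using B(2) PQ fin finS by auto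
    ultimately have U: "\<Union>F = P \<union> Q" by (simp add: set_mono_inj)
    have sub: "F \<subseteq> {P, Q}"
    proof
      fix S assume S: "S \<in> F"
      then have "S \<in> B" "S \<subseteq> P \<union> Q" using F(1) U by auto
      then show "S \<in> {P, Q}" using sp by (simp add: scarf_pair_def)
    qed
    have "\<not> P \<subseteq> Q" "\<not> Q \<subseteq> P" using anti PQ by auto
    moreover have "\<Union>F \<subseteq> Q" if "P \<notin> F" using sub that by auto
    moreover have "\<Union>F \<subseteq> P" if "Q \<notin> F" using sub that by auto
    ultimately have "P \<in> F" "Q \<in> F" using U by auto
    then have "F = {P, Q}" using sub by blast
    then show False using F(2) \<tau>(2) by simp
  qed
  moreover have "{set_mono P, set_mono Q} \<subseteq> mingens I" using mg PQ by auto
  ultimately show "{set_mono P, set_mono Q} \<in> scarf_complex I" unfolding scarf_complex_def by blast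
qed

lemma scarf_sets_connected:
  fixes I :: "('a, 'k::comm_ring_1) mpoly set"
  assumes res: "scarf_is_resolution V I" and V: "finite V"
    and mg: "mingens I = set_mono ` B" and B: "finite B" "\<And>S. S \<in> B \<Longrightarrow> finite S" "{} \<notin> B"
    and anti: "\<And>S T. S \<in> B \<Longrightarrow> T \<in> B \<Longrightarrow> S \<subseteq> T \<Longrightarrow> S = T"
    and W: "W \<subseteq> V" and C: "C \<subseteq> B" "\<And>P. P \<in> C \<Longrightarrow> P \<subseteq> W"
    and A: "A \<in> C" and D: "D \<in> B" "D \<subseteq> W" "D \<notin> C"
  shows "\<exists>P\<in>C. \<exists>Q\<in>B - C. Q \<subseteq> W \<and> scarf_pair B P Q"
proof -
  have finW: "finite W" using W V finite_subset by blast
  have dvd: "mono_dvd (set_mono S) (set_mono W) \<longleftrightarrow> S \<subseteq> W" if "S \<in> B" for S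
    using that B(2) finW by (simp add: set_mono_dvd_iff keys_set_mono)
  have "\<exists>p\<in>set_mono ` C. \<exists>q\<in>mingens I - set_mono ` C. mono_dvd q (set_mono W) \<and> {p, q} \<in> scarf_complex I"
  proof (rule scarf_connected[OF res])
    show "finite (mingens I)" using mg B(1) by simp
    have "set_mono S \<noteq> 0" if "S \<in> B" for S
      using keys_set_mono[of S] B(2,3) that by (metis keys_zero)
    then show "0 \<notin> mingens I" unfolding mg by fastforce
    show "keys (set_mono W) \<subseteq> V" using W finW by (simp add: keys_set_mono)
    show "set_mono ` C \<subseteq> mingens I" using C mg by auto
    show "mono_dvd c (set_mono W)" if "c \<in> set_mono ` C" for c using that C dvd by auto
    show "set_mono A \<in> set_mono ` C" using A by blast
    show "set_mono D \<in> mingens I" "mono_dvd (set_mono D) (set_mono W)" using D mg dvd by auto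
    show "set_mono D \<notin> set_mono ` C"
      using D(1,3) C(1) inj_on_set_mono[of B, OF B(2)] by (auto dest: inj_onD)
  qed
  then obtain P q where P: "P \<in> C" and q: "q \<in> mingens I - set_mono ` C" "mono_dvd q (set_mono W)"
    "{set_mono P, q} \<in> scarf_complex I" by blast
  then obtain Q where Q: "Q \<in> B" "Q \<notin> C" "q = set_mono Q" unfolding mg by blast
  have PB: "P \<in> B" using P C(1) by blast
  have "scarf_pair B P Q"
    using scarf_pair_iff[OF mg B(1,2) anti PB Q(1)] q(3) Q(2,3) P by blast
  moreover have "Q \<subseteq> W" using dvd[OF Q(1)] q(2) Q(3) by simp
  ultimately show ?thesis using P Q by blast
qed

lemma scarf_sets_square:
  fixes I :: "('a, 'k::comm_ring_1) mpoly set"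
  assumes res: "scarf_is_resolution V I" and V: "finite V"
    and mg: "mingens I = set_mono ` B" and B: "finite B" "\<And>S. S \<in> B \<Longrightarrow> finite S"
    and anti: "\<And>S T. S \<in> B \<Longrightarrow> T \<in> B \<Longrightarrow> S \<subseteq> T \<Longrightarrow> S = T"
    and W: "W \<subseteq> V" "P \<union> Q \<union> R \<union> S \<subseteq> W" and dist: "distinct [P, Q, R, S]"
    and sp: "scarf_pair B P Q" "scarf_pair B Q R" "scarf_pair B R S" "scarf_pair B S P"
  shows "\<exists>F\<subseteq>B. card F = 3 \<and> \<Union>F \<subseteq> W \<and> (\<forall>T\<in>B. T \<subseteq> \<Union>F \<longrightarrow> T \<in> F)"
proof -
  have finW: "finite W" using W(1) V finite_subset by blast
  have inB: "P \<in> B" "Q \<in> B" "R \<in> B" "S \<in> B" using sp by (auto simp: scarf_pair_def)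
  note inj = inj_on_set_mono[of B, OF B(2)]
  have dvd: "mono_dvd (set_mono T) (set_mono W) \<longleftrightarrow> T \<subseteq> W" if "T \<in> B" for T
    using that B(2) finW by (simp add: set_mono_dvd_iff keys_set_mono)
  have edge: "{set_mono X, set_mono Y} \<in> scarf_complex I" if "scarf_pair B X Y" for X Y
    using scarf_pair_iff[OF mg B anti, of X Y] that by (auto simp: scarf_pair_def)
  have "\<exists>\<sigma>\<in>scarf_complex I. card \<sigma> = 3 \<and> mono_dvd (mono_lcm \<sigma>) (set_mono W)"
  proof (rule scarf_no_empty_square[OF res])
    show "keys (set_mono W) \<subseteq> V" using W finW by (simp add: keys_set_mono)
    show "distinct [set_mono P, set_mono Q, set_mono R, set_mono S]"
      using dist inB B(2) by (simp add: set_mono_inj)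
  qed (use W(2) inB dvd edge sp in auto)
  then obtain \<sigma> where \<sigma>: "\<sigma> \<in> scarf_complex I" "card \<sigma> = 3" "mono_dvd (mono_lcm \<sigma>) (set_mono W)" by blast
  then have "\<sigma> \<subseteq> set_mono ` B" using mg by (auto simp: scarf_complex_def)
  then obtain F where F: "F \<subseteq> B" "\<sigma> = set_mono ` F" by (rule subset_image_set_mono)
  have fin: "finite F" using F(1) B(1) finite_subset by blast
  have "card F = 3" using \<sigma>(2) F inj by (simp add: card_image inj_on_subset)
  moreover have "\<Union>F \<subseteq> W"
    using \<sigma>(3) F fin dvd by (auto simp: mono_lcm_dvd_iff subset_iff)
  moreover have "\<forall>T\<in>B. T \<subseteq> \<Union>F \<longrightarrow> T \<in> F"
    using scarf_complex_set_mono[OF mg B F(1)] \<sigma>(1) F(2) by blast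
  ultimately show ?thesis using F(1) by blast
qed

text \<open>The union determines the family: a set belongs to it if and only if its private vertex
  lies in the union.\<close>

lemma inj_on_mono_lcm_private:
  assumes B: "finite B" "\<And>S. S \<in> B \<Longrightarrow> finite S"
    and priv: "\<And>S. S \<in> B \<Longrightarrow> \<exists>z\<in>S. \<forall>T\<in>B. z \<in> T \<longrightarrow> T = S"
  shows "inj_on mono_lcm (Pow (set_mono ` B))"
proof (rule inj_onI)
  fix \<sigma> \<tau> assume "\<sigma> \<in> Pow (set_mono ` B)" "\<tau> \<in> Pow (set_mono ` B)" and eq: "mono_lcm \<sigma> = mono_lcm \<tau>"
  then obtain F H where F: "F \<subseteq> B" "\<sigma> = set_mono ` F" and H: "H \<subseteq> B" "\<tau> = set_mono ` H"
    by (meson PowD subset_image_set_mono)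
  have fin: "finite F" "finite H" using F(1) H(1) B(1) finite_subset by blast+
  have finS: "\<And>S. S \<in> F \<Longrightarrow> finite S" "\<And>S. S \<in> H \<Longrightarrow> finite S" using F(1) H(1) B(2) by blast+
  have "set_mono (\<Union>F) = set_mono (\<Union>H)"
    using eq mono_lcm_set_mono[OF fin(1) finS(1)] mono_lcm_set_mono[OF fin(2) finS(2)] F(2) H(2) by simp
  then have U: "\<Union>F = \<Union>H" using fin finS by (subst (asm) set_mono_inj) auto
  have sub: "X \<subseteq> Y" if "X \<subseteq> B" "Y \<subseteq> B" "\<Union>X = \<Union>Y" for X Y
  proof
    fix S assume S: "S \<in> X"
    then obtain z where z: "z \<in> S" "\<forall>T\<in>B. z \<in> T \<longrightarrow> T = S" using priv \<open>X \<subseteq> B\<close> by blast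
    then obtain T where "T \<in> Y" "z \<in> T" using S \<open>\<Union>X = \<Union>Y\<close> by blast
    then show "S \<in> Y" using z \<open>Y \<subseteq> B\<close> by blast
  qed
  have "F = H" using sub[OF F(1) H(1) U] sub[OF H(1) F(1) U[symmetric]] by blast
  then show "\<sigma> = \<tau>" using F(2) H(2) by simp
qed

section \<open>Matchings in graphs with a Scarf squarefree power\<close>

lemma scarf_pairD: "scarf_pair B P Q \<Longrightarrow> R \<in> B \<Longrightarrow> R \<subseteq> P \<union> Q \<Longrightarrow> R = P \<or> R = Q"
  by (simp add: scarf_pair_def)

lemma matched_setsI: "matching E M \<Longrightarrow> card M = n \<Longrightarrow> \<Union>M = S \<Longrightarrow> S \<in> matched_sets E n"
  unfolding matched_sets_def by blast

lemma matched_setsE: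
  assumes "S \<in> matched_sets E n"
  obtains M where "matching E M" "card M = n" "\<Union>M = S"
  using assms unfolding matched_sets_def by blast

section \<open>Exchanging edges of a matching\<close>

lemma matching_disjoint:
  assumes "matching E M" "e \<in> M" "f \<in> M" "x \<in> e" "x \<in> f"
  shows "e = f"
  using assms unfolding matching_def pairwise_def disjnt_def by blast

lemma matching_partner_unique:
  assumes "matching E M" "{x, y} \<in> M" "{x, z} \<in> M"
  shows "y = z"
  using matching_disjoint[OF assms, of x] by (auto simp: doubleton_eq_iff)

lemma matching_partner:
  assumes "simple_graph V E" "matching E M" "x \<in> \<Union>M"
  obtains y where "{x, y} \<in> M" "x \<noteq> y"
proof -
  obtain e where e: "e \<in> M" "x \<in> e" using assms(3) by blast
  have "card e = 2"
    using assms(1,2) e(1) simple_graph_finite(4) unfolding matching_def by blast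
  then obtain y where "e = {x, y}" "x \<noteq> y" using e(2) by (metis card_2_iff doubleton_eq_iff insertE singletonD)
  then show thesis using that e(1) by blast
qed

lemma matching_remove:
  assumes "simple_graph V E" "matching E M" "{x, y} \<in> M"
  shows "matching E (M - {{x, y}})" "card (M - {{x, y}}) = card M - 1" "\<Union>(M - {{x, y}}) = \<Union>M - {x, y}"
proof -
  show "matching E (M - {{x, y}})" using assms(2) by (rule matching_subset) blast
  show "card (M - {{x, y}}) = card M - 1"
    using assms(3) matching_card_Union(2)[OF assms(1,2)] by simp
  show "\<Union>(M - {{x, y}}) = \<Union>M - {x, y}"
    using assms(3) matching_disjoint[OF assms(2)] by blast
qed

text \<open>The basic move: the edge at \<open>w'\<close> is turned from \<open>w\<close> to the
  uncovered vertex \<open>v\<close>. New generators below are produced by this move, possibly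
  repeated or after deleting an edge.\<close>

lemma matching_slide:
  assumes sg: "simple_graph V E" and M: "matching E M" "{w, w'} \<in> M" and v: "v \<notin> \<Union>M" "{v, w'} \<in> E"
  defines "N \<equiv> insert {v, w'} (M - {{w, w'}})"
  shows "matching E N" "card N = card M" "\<Union>N = insert v (\<Union>M - {w})"
proof -
  note r = matching_remove[OF sg M]
  have "{w, w'} \<in> E" using M by (auto simp: matching_def)
  then have ww: "w \<noteq> w'" by (rule simple_graph_edge_neq[OF sg])
  have w': "w' \<in> \<Union>M" using M(2) by blast
  have disj: "{v, w'} \<inter> \<Union>(M - {{w, w'}}) = {}" using v(1) r(3) by auto
  show "matching E N" unfolding N_def by (rule matching_insert[OF r(1) v(2) disj])
  have "{v, w'} \<notin> M - {{w, w'}}" using v(1) by auto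
  moreover have "finite M" "card M > 0" using matching_card_Union(2)[OF sg M(1)] M(2) by (auto simp: card_gt_0_iff)
  ultimately show "card N = card M" unfolding N_def using r(2) by simp
  show "\<Union>N = insert v (\<Union>M - {w})" unfolding N_def using r(3) w' ww by auto
qed

text \<open>The assumptions are what \<open>scarf_sets_connected\<close> and \<open>scarf_sets_square\<close> say about the generators
  of a Scarf squarefree power.\<close>

locale scarf_matchings =
  fixes V :: "'a set" and E :: "'a set set" and n :: nat
  assumes sg: "simple_graph V E"
    and connected: "\<And>W C A D. W \<subseteq> V \<Longrightarrow> C \<subseteq> matched_sets E n \<Longrightarrow> (\<And>P. P \<in> C \<Longrightarrow> P \<subseteq> W) \<Longrightarrow> A \<in> C \<Longrightarrow>
      D \<in> matched_sets E n \<Longrightarrow> D \<subseteq> W \<Longrightarrow> D \<notin> C \<Longrightarrow>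
      \<exists>P\<in>C. \<exists>Q\<in>matched_sets E n - C. Q \<subseteq> W \<and> scarf_pair (matched_sets E n) P Q"
    and square: "\<And>W P Q R S. W \<subseteq> V \<Longrightarrow> P \<union> Q \<union> R \<union> S \<subseteq> W \<Longrightarrow> distinct [P, Q, R, S] \<Longrightarrow>
      scarf_pair (matched_sets E n) P Q \<Longrightarrow> scarf_pair (matched_sets E n) Q R \<Longrightarrow>
      scarf_pair (matched_sets E n) R S \<Longrightarrow> scarf_pair (matched_sets E n) S P \<Longrightarrow>
      \<exists>F\<subseteq>matched_sets E n. card F = 3 \<and> \<Union>F \<subseteq> W \<and> (\<forall>T\<in>matched_sets E n. T \<subseteq> \<Union>F \<longrightarrow> T \<in> F)"
begin

abbreviation B :: "'a set set" where
  "B \<equiv> matched_sets E n"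

lemmas B_props = matched_sets_props[OF sg, of _ n]

text \<open>Two different sets of size 2n have more than 2n elements together, and \<open>W\<close>
  has only one more.\<close>

lemma scarf_pair_Un:
  assumes W: "finite W" "card W = 2 * n + 1" and "scarf_pair B P Q" "P \<subseteq> W" "Q \<subseteq> W"
  shows "P \<union> Q = W"
proof -
  have PQ: "P \<in> B" "Q \<in> B" "P \<noteq> Q" using assms(3) by (auto simp: scarf_pair_def)
  have "card (P \<union> Q) \<noteq> 2 * n"
  proof
    assume c: "card (P \<union> Q) = 2 * n"
    have fin: "finite (P \<union> Q)" using B_props(1) PQ by simp
    have "P = P \<union> Q"
      by (rule card_subset_eq[OF fin Un_upper1]) (simp add: c B_props(3)[OF PQ(1)])
    moreover have "Q = P \<union> Q"
      by (rule card_subset_eq[OF fin Un_upper2]) (simp add: c B_props(3)[OF PQ(2)])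
    ultimately show False using PQ(3) by blast
  qed
  moreover have "card (P \<union> Q) \<ge> 2 * n"
    using B_props(1,3)[OF PQ(1)] B_props(1)[OF PQ(2)] by (metis card_mono finite_UnI sup_ge1)
  moreover have "card (P \<union> Q) \<le> card W" using assms(4,5) W(1) by (intro card_mono) auto
  ultimately show ?thesis using W assms(4,5) by (intro card_subset_eq) auto
qed

text \<open>Connectivity started at \<open>{P}\<close> yields a Scarf edge from \<open>P\<close>
  inside \<open>W\<close>. Its union is all of \<open>W\<close>, so the absence of third generators
  in the union means their absence in \<open>W\<close>.\<close>

lemma at_most_two:
  assumes W: "W \<subseteq> V" "card W = 2 * n + 1"
    and PQR: "P \<in> B" "Q \<in> B" "R \<in> B" "P \<subseteq> W" "Q \<subseteq> W" "R \<subseteq> W"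
  shows "P = Q \<or> P = R \<or> Q = R"
proof (rule ccontr)
  assume ne: "\<not> ?thesis"
  have finW: "finite W" using W(1) simple_graph_finite(1)[OF sg] finite_subset by blast
  obtain T where T: "T \<in> B" "T \<subseteq> W" "scarf_pair B P T"
    using connected[of W "{P}" P Q] W PQR ne by auto
  have "P \<union> T = W" by (rule scarf_pair_Un[OF finW W(2) T(3) PQR(4) T(2)])
  then have "X = P \<or> X = T" if "X \<in> B" "X \<subseteq> W" for X
    using T(3) that by (simp add: scarf_pair_def)
  from this[OF PQR(2,5)] this[OF PQR(3,6)] show False using ne by metis
qed

text \<open>A matching of size \<open>n + 1\<close> is impossible: on its vertex set \<open>W\<close>, encode a matched set
  by the pair of vertices it misses. By \<open>at_most_two\<close>, the resulting graph on \<open>W\<close> has maximal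
  degree 2, and it is connected; following it along three edges of the matching gives a vertex of
  degree 3.\<close>

lemma no_larger_matching:
  assumes M: "matching E M" "card M = Suc n" and n: "n \<ge> 2"
  shows False
proof -
  define W where "W = \<Union>M"
  have W: "W \<subseteq> V" "card W = 2 * n + 2" "finite W" "finite M"
    unfolding W_def using matching_card_Union[OF sg M(1)] M(2) by auto
  define H where "H = (\<lambda>u v. u \<in> W \<and> v \<in> W \<and> u \<noteq> v \<and> W - {u, v} \<in> B)"
  have H_sym: "H u v \<Longrightarrow> H v u" for u v by (auto simp: H_def insert_commute)
  have mate: "\<exists>u'. {u, u'} \<in> M \<and> u \<noteq> u'" if "u \<in> W" for u
    using matching_partner[OF sg M(1)] that unfolding W_def by metis
  have edge_ne: "u \<noteq> v" if "{u, v} \<in> M" for u v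
    using that M(1) simple_graph_edge_neq[OF sg] by (auto simp: matching_def)
  have uniq: "y = z" if "{x, y} \<in> M" "{x, z} \<in> M" for x y z
    by (rule matching_partner_unique[OF M(1) that])
  have inW: "u \<in> W" "v \<in> W" if "{u, v} \<in> M" for u v using that by (auto simp: W_def)
  have H_M: "H u v" if uv: "{u, v} \<in> M" for u v
  proof -
    have "W - {u, v} \<in> B"
    proof (rule matched_setsI)
      show "card (M - {{u, v}}) = n" using matching_remove(2)[OF sg M(1) uv] M(2) by simp
      show "\<Union>(M - {{u, v}}) = W - {u, v}" unfolding W_def by (rule matching_remove(3)[OF sg M(1) uv])
    qed (rule matching_remove(1)[OF sg M(1) uv])
    then show ?thesis using inW[OF uv] edge_ne[OF uv] by (simp add: H_def)
  qed
  \<comment> \<open>The complements of \<open>{u, a}\<close>, \<open>{u, b}\<close> and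
    \<open>{u, c}\<close> all lie in \<open>W - {u}\<close>, which has 2n + 1 vertices.\<close>
  have deg: "a = b \<or> a = c \<or> b = c" if h: "H u a" "H u b" "H u c" for u a b c
  proof -
    have "card (W - {u}) = 2 * n + 1" using W h(1) by (simp add: H_def)
    moreover have "W - {u, a} \<in> B" "W - {u, b} \<in> B" "W - {u, c} \<in> B" using h by (auto simp: H_def)
    ultimately have "W - {u, a} = W - {u, b} \<or> W - {u, a} = W - {u, c} \<or> W - {u, b} = W - {u, c}"
      using W(1) by (intro at_most_two[of "W - {u}"]) auto
    then show ?thesis using h unfolding H_def by blast
  qed
  \<comment> \<open>The edge at \<open>u\<close> is deleted, then the edge at \<open>v'\<close> is
    turned from \<open>v\<close> to the freed vertex \<open>u'\<close>. All other edges stay, which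
    matters when a second move follows.\<close>
  have rewire: "\<exists>N. matching E N \<and> card N = n \<and> \<Union>N = W - {u, v} \<and> M - {{u, u'}, {v, v'}} \<subseteq> N"
    if uv: "{u, u'} \<in> M" "{v, v'} \<in> M" "u \<noteq> v" "u' \<noteq> v" "{u', v'} \<in> E" for u v u' v'
  proof -
    let ?N = "M - {{u, u'}}"
    note r = matching_remove[OF sg M(1) uv(1)]
    have "{v, v'} \<in> ?N" using uv by (auto simp: doubleton_eq_iff)
    moreover have "u' \<notin> \<Union>?N" using r(3) by simp
    ultimately have s: "matching E (insert {u', v'} (?N - {{v, v'}}))"
      "card (insert {u', v'} (?N - {{v, v'}})) = n"
      "\<Union>(insert {u', v'} (?N - {{v, v'}})) = insert u' (W - {u, u'} - {v})"
      using matching_slide[OF sg r(1), of v v' u'] uv(5) r(2,3) M(2) by (auto simp: W_def)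
    have "insert u' (W - {u, u'} - {v}) = W - {u, v}"
      using inW[OF uv(1)] edge_ne[OF uv(1)] uv(4) by auto
    then show ?thesis using s by (intro exI[of _ "insert {u', v'} (?N - {{v, v'}})"]) auto
  qed
  \<comment> \<open>In a matching that misses \<open>u\<close> and \<open>v\<close>, the vertex
    \<open>u'\<close> has some partner \<open>c\<close>. Rewiring \<open>M\<close> along this edge
    makes the mate of \<open>c\<close> in \<open>M\<close> an \<open>H\<close>-neighbour of
    \<open>u\<close>; besides \<open>u'\<close> only \<open>v\<close> is possible, so
    \<open>c\<close> is \<open>v'\<close>.\<close>
  have cross: "{u', v'} \<in> E" if h: "H u v" "{u, v} \<notin> M" "{u, u'} \<in> M" "{v, v'} \<in> M" for u v u' v'
  proof -
    obtain N where N: "matching E N" "card N = n" "\<Union>N = W - {u, v}"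
      using h(1) unfolding H_def by (meson matched_setsE)
    have u': "u' \<noteq> u" "u' \<noteq> v" "u' \<in> W" using h(2,3) edge_ne inW by blast+
    then have "u' \<in> \<Union>N" using N(3) by simp
    then obtain c where c: "{u', c} \<in> N" "u' \<noteq> c" by (rule matching_partner[OF sg N(1)])
    have cE: "{u', c} \<in> E" using c(1) N(1) by (auto simp: matching_def)
    have cW: "c \<in> W" "c \<noteq> u" "c \<noteq> v" using c(1) N(3) by auto
    then obtain c' where c': "{c', c} \<in> M" using mate by (metis insert_commute)
    have "u \<noteq> c'"
      using uniq[of u u' c] h(3) c' c(2) by blast
    have "u' \<noteq> c'" using uniq[of u' u c] h(3) c' cW(2) by (auto simp: insert_commute)
    obtain K where "matching E K" "card K = n" "\<Union>K = W - {u, c'}"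
      using rewire[OF h(3) c' \<open>u \<noteq> c'\<close> \<open>u' \<noteq> c'\<close> cE] by blast
    then have "W - {u, c'} \<in> B" by (rule matched_setsI)
    then have "H u c'" using inW[OF c'] inW[OF h(3)] \<open>u \<noteq> c'\<close> by (simp add: H_def)
    then have "c' = v" using deg[OF H_M[OF h(3)] h(1)] u'(2) \<open>u' \<noteq> c'\<close> by blast
    then have "c = v'" using uniq[of v c v'] c' h(4) by simp
    then show ?thesis using cE by simp
  qed
  \<comment> \<open>\<open>cross\<close> supplies the edges \<open>u'v'\<close> and
    \<open>vd'\<close>. Rewiring along the first gives a matching that misses \<open>u\<close> and
    \<open>v\<close>, and the second moves the gap from \<open>v\<close> to \<open>d\<close>, so
    \<open>d\<close> becomes a third neighbour of \<open>u\<close>.\<close>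
  have key: False
    if h: "H u v" "{u, v} \<notin> M" "{u, u'} \<in> M" "{v, v'} \<in> M" "H v' d" "d \<notin> {u, u', v, v'}" for u v u' v' d
  proof -
    have "d \<in> W" using h(5) by (simp add: H_def)
    then obtain d' where d': "{d, d'} \<in> M" using mate by blast
    have uv: "u \<noteq> v" "u' \<noteq> v" using h(1,2,3) by (auto simp: H_def)
    have v'v: "{v', v} \<in> M" using h(4) by (simp add: insert_commute)
    have "{v', d} \<notin> M" using uniq[OF v'v, of d] h(6) by auto
    then have vd': "{v, d'} \<in> E" using cross[OF h(5) _ v'v d'] by blast
    have u'v': "{u', v'} \<in> E" by (rule cross[OF h(1-4)])
    obtain N where N: "matching E N" "card N = n" "\<Union>N = W - {u, v}" "M - {{u, u'}, {v, v'}} \<subseteq> N"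
      using rewire[OF h(3,4) uv u'v'] by blast
    have "{d, d'} \<in> N" using d' N(4) h(6) by (auto simp: doubleton_eq_iff)
    moreover have "v \<notin> \<Union>N" using N(3) by simp
    ultimately have s: "matching E (insert {v, d'} (N - {{d, d'}}))" "card (insert {v, d'} (N - {{d, d'}})) = n"
      "\<Union>(insert {v, d'} (N - {{d, d'}})) = insert v (W - {u, v} - {d})"
      using matching_slide[OF sg N(1) _ _ vd', of d] N(2,3) by auto
    have "insert v (W - {u, v} - {d}) = W - {u, d}"
      using inW[OF h(4)] uv h(6) by auto
    then have "W - {u, d} \<in> B" using matched_setsI[OF s(1,2)] s(3) by simp
    then have "H u d" using \<open>d \<in> W\<close> inW[OF h(3)] h(6) by (auto simp: H_def)
    then show False using deg[OF H_M[OF h(3)] h(1)] h(6) uv by blast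
  qed
  have missing: "\<exists>a b. H a b \<and> Q = W - {a, b}" if Q: "Q \<in> B" "Q \<subseteq> W" for Q
  proof -
    have "card (W - Q) = 2" using Q W B_props(1,3)[OF Q(1)] by (simp add: card_Diff_subset)
    then obtain a b where ab: "W - Q = {a, b}" "a \<noteq> b" by (meson card_2_iff)
    then have "Q = W - {a, b}" using Q(2) by blast
    moreover have "a \<in> W" "b \<in> W" using ab by auto
    ultimately show ?thesis using Q(1) ab(2) by (auto simp: H_def)
  qed
  \<comment> \<open>Here \<open>n \<ge> 2\<close> is used: \<open>M\<close> has at least three
    edges. The sets \<open>e\<close> and \<open>f\<close> need not be edges, and \<open>{}\<close>
    serves as a dummy.\<close>
  have third: "\<exists>w w'. {w, w'} \<in> M \<and> {w, w'} \<noteq> e \<and> {w, w'} \<noteq> f" for e f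
  proof -
    have "M - {e, f} \<noteq> {}"
    proof
      assume "M - {e, f} = {}"
      then have "card M \<le> card {e, f}" by (intro card_mono) auto
      also have "\<dots> \<le> 2" by (simp add: card_insert_if)
      finally show False using M(2) n by simp
    qed
    then obtain g where g: "g \<in> M" "g \<noteq> e" "g \<noteq> f" by blast
    have "card g = 2" using g(1) M(1) simple_graph_finite(4)[OF sg] by (auto simp: matching_def)
    then obtain w w' where "g = {w, w'}" by (meson card_2_iff)
    then show ?thesis using g by blast
  qed
  have Diff_inj: "X = Y" if "W - X = W - Y" "X \<subseteq> W" "Y \<subseteq> W" for X Y
    using that by blast
  \<comment> \<open>Complements of disjoint pairs have union \<open>W\<close>, and the complement of
    a third edge of \<open>M\<close> would lie in it.\<close>
  have meet: "{a, b} \<inter> {c, d} \<noteq> {}" if h: "H a b" "H c d" "scarf_pair B (W - {a, b}) (W - {c, d})" for a b c d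
  proof
    assume "{a, b} \<inter> {c, d} = {}"
    then have U: "(W - {a, b}) \<union> (W - {c, d}) = W" by blast
    obtain w w' where w: "{w, w'} \<in> M" "{w, w'} \<noteq> {a, b}" "{w, w'} \<noteq> {c, d}"
      using third[of "{a, b}" "{c, d}"] by blast
    have "H w w'" by (rule H_M[OF w(1)])
    then have "W - {w, w'} \<in> B" by (simp add: H_def)
    then have "W - {w, w'} = W - {a, b} \<or> W - {w, w'} = W - {c, d}"
      using scarf_pairD[OF h(3)] U by simp
    moreover have "{w, w'} \<subseteq> W" "{a, b} \<subseteq> W" "{c, d} \<subseteq> W" using inW[OF w(1)] h(1,2) by (auto simp: H_def)
    ultimately show False using w(2,3) Diff_inj by metis
  qed
  \<comment> \<open>Connectivity is applied to the generators whose missing pair lies in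
    \<open>X\<close>. A Scarf edge leaving this family has missing pairs that meet, so some vertex
    has one \<open>H\<close>-neighbour inside \<open>X\<close> and one outside.\<close>
  have leave: "\<exists>a b c. H a b \<and> H a c \<and> {a, b} \<subseteq> X \<and> c \<notin> X"
    if X: "{p, q} \<in> M" "{p, q} \<subseteq> X" "{r, s} \<in> M" "\<not> {r, s} \<subseteq> X" for X p q r s
  proof -
    define C where "C = {W - {a, b} | a b. H a b \<and> {a, b} \<subseteq> X}"
    have CI: "W - {a, b} \<in> C" if "H a b" "{a, b} \<subseteq> X" for a b using that unfolding C_def by blast
    have CE: "\<exists>a b. P = W - {a, b} \<and> H a b \<and> {a, b} \<subseteq> X" if "P \<in> C" for P using that unfolding C_def by blast
    have "\<exists>P\<in>C. \<exists>Q\<in>B - C. Q \<subseteq> W \<and> scarf_pair B P Q"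
    proof (rule connected[OF W(1)])
      show "W - {p, q} \<in> C" by (rule CI[OF H_M[OF X(1)] X(2)])
      show "W - {r, s} \<in> B" using H_M[OF X(3)] by (simp add: H_def)
      show "W - {r, s} \<notin> C"
      proof
        assume "W - {r, s} \<in> C"
        then obtain a b where ab: "W - {r, s} = W - {a, b}" "H a b" "{a, b} \<subseteq> X" using CE by metis
        have "{r, s} \<subseteq> W" "{a, b} \<subseteq> W" using inW[OF X(3)] ab(2) by (auto simp: H_def)
        from Diff_inj[OF ab(1) this] have "{r, s} = {a, b}" .
        then show False using X(4) ab(3) by simp
      qed
      show "C \<subseteq> B" "\<And>P. P \<in> C \<Longrightarrow> P \<subseteq> W" by (auto simp: C_def H_def)
    qed blast
    then obtain P Q where P: "P \<in> C" and Q: "Q \<in> B" "Q \<notin> C" "Q \<subseteq> W" "scarf_pair B P Q" by blast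
    obtain a b where ab: "P = W - {a, b}" "H a b" "{a, b} \<subseteq> X" using CE[OF P] by metis
    obtain c d where cd: "H c d" "Q = W - {c, d}" using missing[OF Q(1,3)] by metis
    have out: "\<not> {c, d} \<subseteq> X" using Q(2) cd CI by metis
    have "{a, b} \<inter> {c, d} \<noteq> {}" using meet[OF ab(2) cd(1)] Q(4) ab(1) cd(2) by simp
    then consider "a = c" | "a = d" | "b = c" | "b = d" by blast
    then show ?thesis
    proof cases
      case 1
      then show ?thesis using ab(2,3) cd(1) out by auto
    next
      case 2
      then show ?thesis using ab(2,3) H_sym[OF cd(1)] out by auto
    next
      case 3
      then show ?thesis using H_sym[OF ab(2)] ab(3) cd(1) out by auto
    next
      case 4
      then show ?thesis using H_sym[OF ab(2)] ab(3) H_sym[OF cd(1)] out by auto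
    qed
  qed
  obtain u0 u0' where e: "{u0, u0'} \<in> M" using third[of "{}" "{}"] by blast
  obtain v0 v0' where f: "{v0, v0'} \<in> M" "{v0, v0'} \<noteq> {u0, u0'}" using third[of "{u0, u0'}" "{}"] by blast
  have "\<not> {v0, v0'} \<subseteq> {u0, u0'}" using f(2) edge_ne[OF f(1)] by auto
  \<comment> \<open>With \<open>X\<close> a single edge of \<open>M\<close>, the
    \<open>H\<close>-edge inside \<open>X\<close> can only be that edge; its ends are renamed so
    that \<open>u\<close> is one with a neighbour outside.\<close>
  then obtain u u' v where uv: "H u u'" "H u v" "{u, u'} \<subseteq> {u0, u0'}" "v \<notin> {u0, u0'}"
    using leave[OF e _ f(1), of "{u0, u0'}"] by blast
  have "{u, u'} = {u0, u0'}" using uv(1,3) by (auto simp: H_def)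
  then have uu': "{u, u'} \<in> M" using e by simp
  have nM: "{u, v} \<notin> M" using uniq[OF uu', of v] \<open>{u, u'} = {u0, u0'}\<close> uv(4) by auto
  have "v \<in> W" using uv(2) by (simp add: H_def)
  then obtain v' where vv': "{v, v'} \<in> M" using mate by blast
  have dist: "u \<noteq> v" "u' \<noteq> v" using uv(4) \<open>{u, u'} = {u0, u0'}\<close> by auto
  obtain w w' where g: "{w, w'} \<in> M" "{w, w'} \<noteq> {u, u'}" "{w, w'} \<noteq> {v, v'}"
    using third[of "{u, u'}" "{v, v'}"] by blast
  have "\<not> {w, w'} \<subseteq> {u, u', v, v'}"
    using g(2,3) matching_disjoint[OF M(1) g(1) uu', of w] matching_disjoint[OF M(1) g(1) vv', of w] by auto
  then obtain a b c where abc: "H a b" "H a c" "{a, b} \<subseteq> {u, u', v, v'}" "c \<notin> {u, u', v, v'}"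
    using leave[OF uu' _ g(1), of "{u, u', v, v'}"] by blast
  \<comment> \<open>\<open>X\<close> now consists of two edges of \<open>M\<close> joined by the
    \<open>H\<close>-edge \<open>uv\<close>. A neighbour outside \<open>X\<close> is a third one for
    \<open>u\<close> or \<open>v\<close>; for \<open>u'\<close> or \<open>v'\<close> it extends the
    path to the situation of \<open>key\<close>.\<close>
  consider "a = u" | "a = v" | "a = u'" | "a = v'" using abc(3) by blast
  then show False
  proof cases
    case 1
    then show False using deg[OF uv(1,2), of c] abc dist by auto
  next
    case 2
    have "u \<noteq> v'" using nM vv' by (auto simp: insert_commute)
    with 2 show False using deg[OF H_sym[OF uv(2)] H_M[OF vv'], of c] abc by auto
  next
    case 3
    then show False
      using key[OF H_sym[OF uv(2)] _ vv' uu'] nM abc by (auto simp: insert_commute)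
  next
    case 4
    then show False using key[OF uv(2) nM uu' vv'] abc by auto
  qed
qed

end

text \<open>Read \<open>a\<close>, \<open>b\<close>, \<open>c\<close>, \<open>d\<close> as
  consecutive corners of a square: a set of corners without two opposite ones has at most one from
  each diagonal.\<close>

lemma card_le_2_if_misses:
  assumes "F \<subseteq> {a, b, c, d}" "a \<notin> F \<or> c \<notin> F" "b \<notin> F \<or> d \<notin> F"
  shows "card F \<le> 2"
proof -
  have "\<exists>x y. F \<subseteq> {x, y}"
  proof -
    consider "a \<notin> F" "b \<notin> F" | "c \<notin> F" "b \<notin> F" | "a \<notin> F" "d \<notin> F" | "c \<notin> F" "d \<notin> F"
      using assms(2,3) by argo
    then show ?thesis
    proof cases
      case 1
      then have "F \<subseteq> {c, d}" using assms(1) by auto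
      then show ?thesis by (intro exI)
    next
      case 2
      then have "F \<subseteq> {a, d}" using assms(1) by auto
      then show ?thesis by (intro exI)
    next
      case 3
      then have "F \<subseteq> {b, c}" using assms(1) by auto
      then show ?thesis by (intro exI)
    next
      case 4
      then have "F \<subseteq> {a, b}" using assms(1) by auto
      then show ?thesis by (intro exI)
    qed
  qed
  then obtain x y where "F \<subseteq> {x, y}" by (elim exE)
  then have "card F \<le> card {x, y}" by (intro card_mono) simp_all
  also have "\<dots> \<le> 2" by (simp add: card_insert_if)
  finally show ?thesis .
qed

section \<open>Vertices missed by a maximum matching\<close>

context scarf_matchings
begin

text \<open>A neighbour missed by \<open>M\<close> would enlarge \<open>M\<close>, so each neighbour
  is covered and the slide applies to it. The resulting covered set is determined by the mate that
  is dropped, and different neighbours have different mates.\<close>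

lemma unmatched_nbrs:
  assumes no_isolated: "\<And>v. v \<in> V \<Longrightarrow> nbrs E v \<noteq> {}" and max: "\<And>M. matching E M \<Longrightarrow> card M \<le> n"
    and M: "matching E M" "card M = n" and v: "v \<in> V" "v \<notin> \<Union>M"
  shows "\<exists>c d. {d, c} \<in> M \<and> nbrs E v = {c}"
proof -
  have mate: "\<exists>d. {d, c} \<in> M" if c: "{v, c} \<in> E" for c
  proof -
    have "c \<in> \<Union>M"
    proof (rule ccontr)
      assume "c \<notin> \<Union>M"
      then have "matching E (insert {v, c} M)" using matching_insert[OF M(1) c] v(2) by simp
      moreover have "{v, c} \<notin> M" using v(2) by blast
      ultimately show False using max[of "insert {v, c} M"] matching_card_Union(2)[OF sg M(1)] M(2) by simp
    qed
    then obtain d where "{c, d} \<in> M" by (rule matching_partner[OF sg M(1)])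
    then show ?thesis by (metis insert_commute)
  qed
  have swap: "insert v (\<Union>M - {d}) \<in> B" if "{v, c} \<in> E" "{d, c} \<in> M" for c d
    using matched_setsI[OF matching_slide(1,2)[OF sg M(1) that(2) v(2) that(1)]]
      matching_slide(3)[OF sg M(1) that(2) v(2) that(1)] M(2) by simp
  have MB: "\<Union>M \<in> B" using M by (blast intro: matched_setsI)
  note MU = matching_card_Union[OF sg M(1)]
  obtain c where c: "{v, c} \<in> E" using no_isolated[OF v(1)] by (auto simp: nbrs_def)
  obtain d where d: "{d, c} \<in> M" using mate[OF c] by blast
  have "x = c" if x: "{v, x} \<in> E" for x
  proof -
    obtain y where y: "{y, x} \<in> M" using mate[OF x] by blast
    have dM: "d \<in> \<Union>M" "y \<in> \<Union>M" using d y by auto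
    let ?W = "insert v (\<Union>M)"
    have "\<Union>M = insert v (\<Union>M - {d}) \<or> \<Union>M = insert v (\<Union>M - {y}) \<or> insert v (\<Union>M - {d}) = insert v (\<Union>M - {y})"
    proof (rule at_most_two[of ?W])
      show "?W \<subseteq> V" using MU(3) v(1) by simp
      show "card ?W = 2 * n + 1" using MU(1,4) M(2) v(2) by simp
    qed (use MB swap[OF c d] swap[OF x y] in auto)
    then have "insert v (\<Union>M - {d}) = insert v (\<Union>M - {y})" using v(2) by (metis insertI1)
    moreover have "d \<notin> insert v (\<Union>M - {d})" using dM(1) v(2) by auto
    ultimately have "d \<notin> insert v (\<Union>M - {y})" by simp
    then have "d = y" using dM(1) by blast
    then show ?thesis using matching_partner_unique[OF M(1), of d c x] d y by simp
  qed
  then have "nbrs E v = {c}" unfolding nbrs_def using c by blast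
  then show ?thesis using d by blast
qed

text \<open>Sliding to \<open>v\<close> produces another matching of size \<open>n\<close>, and this
  one misses \<open>d\<close>; so what is known about \<open>v\<close> also holds for
  \<open>d\<close>. Since \<open>c\<close> is a neighbour of \<open>d\<close>, the joints
  agree.\<close>

lemma unmatched_leaf:
  assumes no_isolated: "\<And>v. v \<in> V \<Longrightarrow> nbrs E v \<noteq> {}" and max: "\<And>M. matching E M \<Longrightarrow> card M \<le> n"
    and M: "matching E M" "card M = n" and v: "v \<in> V" "v \<notin> \<Union>M"
  shows "\<exists>c d. {d, c} \<in> M \<and> nbrs E v = {c} \<and> nbrs E d = {c}"
proof -
  obtain c d where cd: "{d, c} \<in> M" "nbrs E v = {c}"
    using unmatched_nbrs[OF no_isolated max M v] by blast
  have vc: "{v, c} \<in> E" using cd(2) by (auto simp: nbrs_def)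
  have dc: "{d, c} \<in> E" using cd(1) M(1) by (auto simp: matching_def)
  note s = matching_slide[OF sg M(1) cd(1) v(2) vc]
  have "d \<in> V" using dc simple_graph_finite(5)[OF sg] by blast
  moreover have "d \<notin> insert v (\<Union>M - {d})" using cd(1) v(2) by auto
  ultimately obtain c' where "nbrs E d = {c'}"
    using unmatched_nbrs[OF no_isolated max s(1), of d] s(2,3) M(2) by auto
  moreover have "c \<in> nbrs E d" using dc by (simp add: nbrs_def)
  ultimately have "nbrs E d = {c}" by simp
  then show ?thesis using cd by blast
qed

text \<open>Two different joints would give a square of four Scarf edges without Scarf triangles.\<close>

lemma unmatched_same_joint:
  assumes M: "matching E M" "card M = n"
    and v: "v1 \<in> V" "v1 \<notin> \<Union>M" "v2 \<in> V" "v2 \<notin> \<Union>M"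
    and cd1: "{d1, c1} \<in> M" "nbrs E v1 = {c1}" "nbrs E d1 = {c1}"
    and cd2: "{d2, c2} \<in> M" "nbrs E v2 = {c2}" "nbrs E d2 = {c2}"
  shows "c1 = c2"
proof (rule ccontr)
  assume ne: "c1 \<noteq> c2"
  define W where "W = insert v1 (insert v2 (\<Union>M))"
  note MU = matching_card_Union[OF sg M(1)]
  have dM: "d1 \<in> \<Union>M" "d2 \<in> \<Union>M" using cd1(1) cd2(1) by auto
  have dist: "v1 \<noteq> v2" "d1 \<noteq> d2" "v1 \<noteq> d1" "v1 \<noteq> d2" "v2 \<noteq> d1" "v2 \<noteq> d2"
    using ne cd1 cd2 v dM by auto
  have W: "W \<subseteq> V" "card W = 2 * n + 2" "finite W"
    using MU M(2) v dist by (auto simp: W_def)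
  have inW: "v1 \<in> W" "v2 \<in> W" "d1 \<in> W" "d2 \<in> W" using dM by (auto simp: W_def)
  have e1: "{v1, c1} \<in> E" "{v2, c2} \<in> E" using cd1 cd2 by (auto simp: nbrs_def)
  \<comment> \<open>The corners omit one of \<open>v1\<close>, \<open>d1\<close> and one of
    \<open>v2\<close>, \<open>d2\<close>. They are listed cyclically, so that consecutive corners
    share an omitted vertex.\<close>
  let ?P = "W - {v1, v2}" let ?Q = "W - {d1, v2}" let ?R = "W - {d1, d2}" let ?S = "W - {v1, d2}"
  have PB: "?P \<in> B" by (rule matched_setsI[OF M]) (use v in \<open>auto simp: W_def\<close>)
  note s1 = matching_slide[OF sg M(1) cd1(1) v(2) e1(1)]
  note s2 = matching_slide[OF sg M(1) cd2(1) v(4) e1(2)]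
  have Q: "insert v1 (\<Union>M - {d1}) = ?Q" and S: "insert v2 (\<Union>M - {d2}) = ?S"
    and R: "insert v2 (insert v1 (\<Union>M - {d1}) - {d2}) = ?R"
    using v dist by (auto simp: W_def)
  have QB: "?Q \<in> B"
    by (rule matched_setsI[OF s1(1)]) (simp_all only: s1(2,3) M(2) Q)
  have SB: "?S \<in> B"
    by (rule matched_setsI[OF s2(1)]) (simp_all only: s2(2,3) M(2) S)
  let ?N = "insert {v1, c1} (M - {{d1, c1}})"
  \<comment> \<open>This keeps the two matching edges apart, so that the second one survives the
    first slide.\<close>
  have "d2 \<noteq> c1"
  proof
    assume "d2 = c1"
    then have "v1 \<in> nbrs E d2" using e1(1) by (simp add: nbrs_def insert_commute)
    then have "v1 = c2" using cd2(3) by simp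
    then show False using v(2) cd2(1) by blast
  qed
  then have "{d2, c2} \<noteq> {d1, c1}" using dist(2) by (auto simp: doubleton_eq_iff)
  then have "{d2, c2} \<in> ?N" using cd2(1) by simp
  moreover have "v2 \<notin> \<Union>?N" using s1(3) v(4) dist by simp
  ultimately have s3: "matching E (insert {v2, c2} (?N - {{d2, c2}}))" "card (insert {v2, c2} (?N - {{d2, c2}})) = n"
    "\<Union>(insert {v2, c2} (?N - {{d2, c2}})) = insert v2 (\<Union>?N - {d2})"
    using matching_slide[OF sg s1(1), of d2 c2 v2] e1(2) s1(2) M(2) by auto
  have RB: "?R \<in> B"
    by (rule matched_setsI[OF s3(1,2)]) (simp only: s3(3) s1(3) R)
  \<comment> \<open>The joint can be matched only once, so no matching covers two leaves with the
    same joint.\<close>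
  have leaves: "\<not> (x \<in> T \<and> y \<in> T)" if "T \<in> B" "nbrs E x = {c}" "nbrs E y = {c}" "x \<noteq> y" for T x y c
  proof
    assume xy: "x \<in> T \<and> y \<in> T"
    obtain N where N: "matching E N" "\<Union>N = T" using \<open>T \<in> B\<close> by (rule matched_setsE)
    have edge: "{z, c} \<in> N" if z: "z \<in> T" "nbrs E z = {c}" for z
    proof -
      have "z \<in> \<Union>N" using z(1) N(2) by simp
      then obtain w where w: "{z, w} \<in> N" by (rule matching_partner[OF sg N(1)])
      then have "w \<in> nbrs E z" using N(1) by (auto simp: nbrs_def matching_def)
      then show ?thesis using w z(2) by simp
    qed
    have "{x, c} \<in> N" "{y, c} \<in> N" using xy edge that(2,3) by simp_all
    then have "x = y" using matching_partner_unique[OF N(1), of c x y] by (simp add: insert_commute)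
    then show False using \<open>x \<noteq> y\<close> by simp
  qed
  \<comment> \<open>A generator in \<open>W\<close> therefore omits one vertex of each pair, and by
    its size 2n nothing else.\<close>
  have all: "T = ?P \<or> T = ?Q \<or> T = ?R \<or> T = ?S" if T: "T \<in> B" "T \<subseteq> W" for T
  proof -
    obtain x where x: "x \<in> {v1, d1}" "x \<notin> T" using leaves[OF T(1) cd1(2,3) dist(3)] by blast
    obtain y where y: "y \<in> {v2, d2}" "y \<notin> T" using leaves[OF T(1) cd2(2,3) dist(6)] by blast
    have "x \<noteq> y" "x \<in> W" "y \<in> W" using x y dist inW by auto
    then have c: "card (W - {x, y}) = 2 * n" using W by (simp add: card_Diff_subset)
    have "T \<subseteq> W - {x, y}" using T(2) x y by auto
    then have "T = W - {x, y}"
      using W(3) c B_props(3)[OF T(1)] by (intro card_subset_eq) auto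
    then show ?thesis using x y by (auto simp: insert_commute)
  qed
  define P Q R S where "P = ?P" and "Q = ?Q" and "R = ?R" and "S = ?S"
  note defs = this
  have inB: "P \<in> B" "Q \<in> B" "R \<in> B" "S \<in> B" using PB QB RB SB by (simp_all only: defs)
  have sub: "P \<subseteq> W" "Q \<subseteq> W" "R \<subseteq> W" "S \<subseteq> W" by (auto simp: defs)
  have cases: "T = P \<or> T = Q \<or> T = R \<or> T = S" if "T \<in> B" "T \<subseteq> W" for T
    using all[OF that] by (simp only: defs)
  have mem: "v1 \<in> Q" "v1 \<in> R" "v1 \<notin> P" "v1 \<notin> S" "v2 \<in> R" "v2 \<in> S" "v2 \<notin> P" "v2 \<notin> Q"
    "d1 \<in> P" "d1 \<in> S" "d1 \<notin> Q" "d1 \<notin> R" "d2 \<in> P" "d2 \<in> Q" "d2 \<notin> R" "d2 \<notin> S"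
    using inW dist by (auto simp: defs)
  have "P \<union> R = W" "Q \<union> S = W" using dist inW by (auto simp: defs)
  note Un = this
  have d4: "P \<noteq> Q" "P \<noteq> R" "P \<noteq> S" "Q \<noteq> R" "Q \<noteq> S" "R \<noteq> S" using mem by blast+
  \<comment> \<open>Consecutive corners both omit \<open>z\<close>, while the other two contain it;
    so a generator in their union is one of them.\<close>
  have pair: "scarf_pair B X Y"
    if "X \<in> B" "Y \<in> B" "X \<noteq> Y" "X \<subseteq> W" "Y \<subseteq> W" "z \<notin> X" "z \<notin> Y"
      "\<And>T. T \<in> B \<Longrightarrow> T \<subseteq> W \<Longrightarrow> z \<notin> T \<Longrightarrow> T = X \<or> T = Y" for X Y z
    unfolding scarf_pair_def
  proof (intro conjI ballI impI that(1-3))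
    fix T assume T: "T \<in> B" "T \<subseteq> X \<union> Y"
    then have "T \<subseteq> W" "z \<notin> T" using that(4-7) by auto
    then show "T = X \<or> T = Y" using that(8)[OF T(1)] by blast
  qed
  have "scarf_pair B P Q"
    by (rule pair[OF inB(1,2) d4(1) sub(1,2) mem(7,8)]) (metis cases mem(5,6))
  moreover have "scarf_pair B Q R"
    by (rule pair[OF inB(2,3) d4(4) sub(2,3) mem(11,12)]) (metis cases mem(9,10))
  moreover have "scarf_pair B R S"
    by (rule pair[OF inB(3,4) d4(6) sub(3,4) mem(15,16)]) (metis cases mem(13,14))
  moreover have "scarf_pair B S P"
    by (rule pair[OF inB(4,1) d4(3)[symmetric] sub(4,1) mem(4,3)]) (metis cases mem(1,2))
  moreover have "P \<union> Q \<union> R \<union> S \<subseteq> W" using sub by blast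
  moreover have "distinct [P, Q, R, S]" using d4 by simp
  ultimately have "\<exists>F\<subseteq>B. card F = 3 \<and> \<Union>F \<subseteq> W \<and> (\<forall>T\<in>B. T \<subseteq> \<Union>F \<longrightarrow> T \<in> F)"
    by (intro square[OF W(1)])
  then obtain F where F: "F \<subseteq> B" "card F = 3" "\<Union>F \<subseteq> W" and closed: "\<And>T. T \<in> B \<Longrightarrow> T \<subseteq> \<Union>F \<Longrightarrow> T \<in> F"
    by meson
  have F4: "F \<subseteq> {P, Q, R, S}"
  proof
    fix T assume "T \<in> F"
    then have "T \<in> B" "T \<subseteq> W" using F(1,3) by auto
    then show "T \<in> {P, Q, R, S}" using cases[of T] by simp
  qed
  have c4: "card {P, Q, R, S} = 4" using d4 by simp
  \<comment> \<open>Three of the four corners include two opposite ones, and these already cover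
    \<open>W\<close>. Closure under generators in the union then forces all four into
    \<open>F\<close>.\<close>
  have "P \<in> F \<and> R \<in> F \<or> Q \<in> F \<and> S \<in> F"
  proof (rule ccontr)
    assume "\<not> ?thesis"
    then have "card F \<le> 2" by (intro card_le_2_if_misses[OF F4]) simp_all
    then show False using F(2) by simp
  qed
  then have "W \<subseteq> \<Union>F" using Un by (metis Sup_upper Un_least)
  then have "{P, Q, R, S} \<subseteq> F" using closed inB sub by (meson empty_subsetI insert_subset order_trans)
  then have "card {P, Q, R, S} \<le> card F" using F(2) by (intro card_mono) (auto intro: card_ge_0_finite)
  then show False using F(2) c4 by simp
qed

end

text \<open>The distinguished edge receives the last number. Injectivity is a matter of counting: 2n
  indices are mapped onto a set with 2n elements.\<close>

lemma matching_labelling: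
  assumes sg: "simple_graph V E" and M: "matching E M" "card M = n" "{d, c} \<in> M"
  shows "\<exists>x :: nat \<Rightarrow> 'a. inj_on x {1..2 * n} \<and> x ` {1..2 * n} = \<Union>M \<and>
    {{x (2 * i - 1), x (2 * i)} | i. i \<in> {1..n}} = M \<and> x (2 * n - 1) = c \<and> x (2 * n) = d"
proof -
  note MU = matching_card_Union[OF sg M(1)]
  have n: "n \<ge> 1" using M(2,3) MU(2) by (metis One_nat_def Suc_leI card_gt_0_iff empty_iff)
  have "finite (M - {{d, c}})" "card (M - {{d, c}}) = n - 1"
    using MU(2) M(2,3) by auto
  then obtain h where h: "bij_betw h {1..n - 1} (M - {{d, c}})"
    using ex_bij_betw_nat_finite_1[of "M - {{d, c}}"] by auto
  define e where "e = h(n := {d, c})"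
  have e: "e ` {1..n} = M"
  proof -
    have "{1..n} = insert n {1..n - 1}" using n by auto
    moreover have "e ` {1..n - 1} = h ` {1..n - 1}" using n by (intro image_cong) (auto simp: e_def)
    moreover have "h ` {1..n - 1} = M - {{d, c}}" using h by (simp add: bij_betw_def)
    ultimately show ?thesis using M(3) by (auto simp: e_def)
  qed
  have "\<exists>p q. e i = {p, q} \<and> (i = n \<longrightarrow> p = c \<and> q = d)" if i: "i \<in> {1..n}" for i
  proof (cases "i = n")
    case True
    then show ?thesis by (auto simp: e_def)
  next
    case False
    have "e i \<in> E" using e i M(1) unfolding matching_def by blast
    then have "card (e i) = 2" by (rule simple_graph_finite(4)[OF sg])
    then show ?thesis using False by (metis card_2_iff)
  qed
  then obtain p q where pq: "\<And>i. i \<in> {1..n} \<Longrightarrow> e i = {p i, q i}" "\<And>i. i \<in> {1..n} \<Longrightarrow> i = n \<Longrightarrow> p i = c \<and> q i = d"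
    by metis
  \<comment> \<open>Odd indices carry the first end and even indices the second end of an edge;
    \<open>Suc j div 2\<close> turns \<open>j = 2 * i - 1\<close> into \<open>i\<close>.\<close>
  define x where "x = (\<lambda>j. if odd j then p (Suc j div 2) else q (j div 2))"
  have x: "x (2 * i - 1) = p i" "x (2 * i) = q i" if i: "i \<in> {1..n}" for i
  proof -
    obtain k where "i = Suc k" using i by (cases i) auto
    then show "x (2 * i - 1) = p i" "x (2 * i) = q i" by (simp_all add: x_def)
  qed
  have pairs: "{{x (2 * i - 1), x (2 * i)} | i. i \<in> {1..n}} = M"
  proof -
    have "{{x (2 * i - 1), x (2 * i)} | i. i \<in> {1..n}} = (\<lambda>i. {x (2 * i - 1), x (2 * i)}) ` {1..n}" by blast
    also have "\<dots> = e ` {1..n}" using x pq(1) by (intro image_cong) auto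
    finally show ?thesis using e by simp
  qed
  have idx: "j \<in> {1..2 * n} \<Longrightarrow> \<exists>i\<in>{1..n}. j = 2 * i - 1 \<or> j = 2 * i" for j
    by (cases "even j") (auto elim!: evenE oddE intro: bexI[of _ "Suc j div 2"])
  have img: "x ` {1..2 * n} = \<Union>M"
  proof
    show "x ` {1..2 * n} \<subseteq> \<Union>M" using idx pairs by blast
    show "\<Union>M \<subseteq> x ` {1..2 * n}" unfolding pairs[symmetric] by fastforce
  qed
  have "inj_on x {1..2 * n}"
    by (rule eq_card_imp_inj_on) (use img MU(1) M(2) in auto)
  moreover have "x (2 * n - 1) = c" "x (2 * n) = d" using x[of n] pq(2)[of n] n by auto
  ultimately show ?thesis using img pairs by blast
qed

section \<open>Transfer between the ideal and the graph\<close>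

lemma keys_set_mono_matched_sets:
  assumes "simple_graph V E" "a \<in> set_mono ` matched_sets E n"
  shows "keys a \<subseteq> V"
proof -
  obtain S where "S \<in> matched_sets E n" "a = set_mono S" using assms(2) by blast
  then show ?thesis using matched_sets_props(1,2)[OF assms(1), of S n] by (simp add: keys_set_mono)
qed

lemma mingens_squarefree_power:
  assumes sg: "simple_graph V E"
  shows "mingens (squarefree_power V (edge_ideal V E) n :: ('a, 'k::comm_ring_1) mpoly set) = set_mono ` matched_sets E n"
  unfolding squarefree_power_eq[OF sg]
proof (rule mingens_mono_ideal)
  show "keys a \<subseteq> V" if "a \<in> set_mono ` matched_sets E n" for a
    by (rule keys_set_mono_matched_sets[OF sg that])
next
  fix a b assume "a \<in> set_mono ` matched_sets E n" "b \<in> set_mono ` matched_sets E n" and d: "mono_dvd a b"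
  then obtain S T where S: "S \<in> matched_sets E n" "a = set_mono S" and T: "T \<in> matched_sets E n" "b = set_mono T"
    by blast
  have "S \<subseteq> T"
    using d S T matched_sets_props(1)[OF sg] by (simp add: set_mono_dvd_iff keys_set_mono)
  then show "a = b" using matched_sets_subset_eq[OF sg S(1) T(1)] S(2) T(2) by simp
qed

lemma scarf_matchings_if_scarf_ideal:
  assumes sg: "simple_graph V E" and n: "n \<ge> 1"
    and scarf: "scarf_ideal V (squarefree_power V (edge_ideal V E) n :: ('a, 'k::comm_ring_1) mpoly set)"
  shows "scarf_matchings V E n"
proof -
  let ?I = "squarefree_power V (edge_ideal V E) n :: ('a, 'k) mpoly set"
  let ?B = "matched_sets E n"
  have res: "scarf_is_resolution V ?I" using scarf by (simp add: scarf_ideal_def)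
  have V: "finite V" by (rule simple_graph_finite(1)[OF sg])
  note mg = mingens_squarefree_power[OF sg]
  have fin: "finite ?B" by (rule finite_matched_sets[OF sg])
  have finS: "finite S" if "S \<in> ?B" for S by (rule matched_sets_props(1)[OF sg that])
  have anti: "S = T" if "S \<in> ?B" "T \<in> ?B" "S \<subseteq> T" for S T by (rule matched_sets_subset_eq[OF sg that])
  \<comment> \<open>For \<open>n \<ge> 1\<close> the empty set is no matched set, so the monomial 1
    is not a generator.\<close>
  have ne: "{} \<notin> ?B" using matched_sets_props(3)[OF sg, of "{}" n] n by auto
  show ?thesis
  proof
    show "simple_graph V E" by (rule sg)
  next
    fix W C A D
    assume *: "W \<subseteq> V" "C \<subseteq> ?B" "\<And>P. P \<in> C \<Longrightarrow> P \<subseteq> W" "A \<in> C" "D \<in> ?B" "D \<subseteq> W" "D \<notin> C"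
    show "\<exists>P\<in>C. \<exists>Q\<in>?B - C. Q \<subseteq> W \<and> scarf_pair ?B P Q"
      by (rule scarf_sets_connected[OF res V mg fin finS ne anti *])
  next
    fix W P Q R S
    assume *: "W \<subseteq> V" "P \<union> Q \<union> R \<union> S \<subseteq> W" "distinct [P, Q, R, S]"
      "scarf_pair ?B P Q" "scarf_pair ?B Q R" "scarf_pair ?B R S" "scarf_pair ?B S P"
    show "\<exists>F\<subseteq>?B. card F = 3 \<and> \<Union>F \<subseteq> W \<and> (\<forall>T\<in>?B. T \<subseteq> \<Union>F \<longrightarrow> T \<in> F)"
      by (rule scarf_sets_square[OF res V mg fin finS anti *])
  qed
qed

lemma scarf_ideal_if_private:
  assumes sg: "simple_graph V E"
    and priv: "\<And>S. S \<in> matched_sets E n \<Longrightarrow> \<exists>z\<in>S. \<forall>T\<in>matched_sets E n. z \<in> T \<longrightarrow> T = S"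
  shows "scarf_ideal V (squarefree_power V (edge_ideal V E) n :: ('a, 'k::comm_ring_1) mpoly set)"
  unfolding squarefree_power_eq[OF sg]
proof (rule scarf_ideal_if_lcm_inj)
  show "finite (set_mono ` matched_sets E n)" using finite_matched_sets[OF sg] by simp
  show "keys a \<subseteq> V" if "a \<in> set_mono ` matched_sets E n" for a
    by (rule keys_set_mono_matched_sets[OF sg that])
  show "inj_on mono_lcm (Pow (set_mono ` matched_sets E n))"
    by (rule inj_on_mono_lcm_private[OF finite_matched_sets[OF sg] matched_sets_props(1)[OF sg] priv])
qed

text \<open>A matched set has as many elements as \<open>V\<close>, so \<open>V\<close> is the only
  one and any vertex is private to it.\<close>

lemma scarf_ideal_perfect_matching:
  assumes sg: "simple_graph V E" and "V \<noteq> {}" and M: "perfect_matching V E M" "card M = n"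
  shows "scarf_ideal V (squarefree_power V (edge_ideal V E) n :: ('a, 'k::comm_ring_1) mpoly set)"
proof (rule scarf_ideal_if_private[OF sg])
  have "card V = 2 * n"
    using matching_card_Union(1)[OF sg, of M] M by (auto simp: perfect_matching_def)
  then have "S = V" if "S \<in> matched_sets E n" for S
    using matched_sets_props[OF sg that] simple_graph_finite(1)[OF sg] by (intro card_subset_eq) auto
  then show "\<exists>z\<in>S. \<forall>T\<in>matched_sets E n. z \<in> T \<longrightarrow> T = S" if "S \<in> matched_sets E n" for S
    using that assms(2) by (metis ex_in_conv)
qed

text \<open>\<open>L\<close> is a set of leaves at \<open>c\<close>; a matching uses
  \<open>c\<close> at most once, so it covers at most one of them. As only 2n - 1 vertices lie
  outside \<open>L\<close>, a matched set must take all of these and exactly one leaf, which is then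
  private to it.\<close>

lemma scarf_ideal_common_joint:
  assumes sg: "simple_graph V E" and L: "L \<subseteq> V" "card (V - L) = 2 * n - 1" and n: "n \<ge> 1"
    and leaf: "\<And>v. v \<in> L \<Longrightarrow> nbrs E v = {c}"
  shows "scarf_ideal V (squarefree_power V (edge_ideal V E) n :: ('a, 'k::comm_ring_1) mpoly set)"
proof (rule scarf_ideal_if_private[OF sg])
  have shape: "\<exists>z. T \<inter> L = {z} \<and> T = insert z (V - L)" if T: "T \<in> matched_sets E n" for T
  proof -
    note p = matched_sets_props[OF sg T]
    obtain N where N: "matching E N" "\<Union>N = T" using T by (rule matched_setsE)
    have edge: "{z, c} \<in> N" if z: "z \<in> T" "z \<in> L" for z
    proof -
      have "z \<in> \<Union>N" using z(1) N(2) by simp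
      then obtain w where w: "{z, w} \<in> N" by (rule matching_partner[OF sg N(1)])
      then have "w \<in> nbrs E z" using N(1) by (auto simp: nbrs_def matching_def)
      then show ?thesis using w leaf[OF z(2)] by simp
    qed
    have one: "x = y" if xy: "x \<in> T" "x \<in> L" "y \<in> T" "y \<in> L" for x y
      using matching_partner_unique[OF N(1), of c x y] edge[OF xy(1,2)] edge[OF xy(3,4)]
      by (simp add: insert_commute)
    have finV: "finite V" by (rule simple_graph_finite(1)[OF sg])
    have sub: "T - L \<subseteq> V - L" using p(2) by blast
    have "card (T - L) \<le> 2 * n - 1" using L(2) card_mono[OF _ sub] finV by simp
    then have "\<not> T \<subseteq> V - L" using p(3) n card_mono[of "V - L" T] L(2) finV by auto
    then obtain z where z: "z \<in> T" "z \<in> L" using p(2) by blast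
    have TL: "T \<inter> L = {z}" using z one by blast
    have "card T = card (T - L) + card (T \<inter> L)"
      using p(1) by (metis Int_Diff_Un Int_Diff_disjoint add.commute card_Un_disjoint finite_Diff finite_Int)
    then have "card (T - L) = card (V - L)" using TL p(3) L(2) by simp
    then have "T - L = V - L" using finV sub by (intro card_subset_eq) auto
    then have "T = insert z (V - L)" using TL by blast
    then show ?thesis using TL by blast
  qed
  fix S assume "S \<in> matched_sets E n"
  then obtain z where z: "S \<inter> L = {z}" "S = insert z (V - L)" using shape by metis
  have "T = S" if T: "T \<in> matched_sets E n" "z \<in> T" for T
  proof -
    obtain y where y: "T \<inter> L = {y}" "T = insert y (V - L)" using shape[OF T(1)] by metis
    have "z \<in> L" using z(1) by blast
    then have "z = y" using y(1) T(2) by blast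
    then show ?thesis using y(2) z(2) by simp
  qed
  then show "\<exists>z\<in>S. \<forall>T\<in>matched_sets E n. z \<in> T \<longrightarrow> T = S" using z(1) by blast
qed

lemma (in scarf_matchings) common_joint:
  assumes n: "n \<ge> 2" and no_isolated: "\<And>v. v \<in> V \<Longrightarrow> nbrs E v \<noteq> {}"
    and M: "matching E M" "card M = n" and ne: "\<Union>M \<noteq> V"
  shows "\<exists>c d. {d, c} \<in> M \<and> (\<forall>v\<in>insert d (V - \<Union>M). nbrs E v = {c})"
proof -
  have max: "card N \<le> n" if N: "matching E N" for N
  proof (rule ccontr)
    assume "\<not> card N \<le> n"
    \<comment> \<open>Only size n + 1 has been excluded so far, but a larger matching contains one
      of that size.\<close>
    then obtain K where K: "K \<subseteq> N" "card K = Suc n"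
      by (metis not_less_eq_eq obtain_subset_with_card_n)
    show False by (rule no_larger_matching[OF matching_subset[OF N K(1)] K(2) n])
  qed
  have ex: "\<exists>c d. {d, c} \<in> M \<and> nbrs E v = {c} \<and> nbrs E d = {c}" if "v \<in> V" "v \<notin> \<Union>M" for v
    by (rule unmatched_leaf[OF no_isolated max M that])
  obtain v where v: "v \<in> V" "v \<notin> \<Union>M" using ne matching_card_Union(3)[OF sg M(1)] by blast
  obtain c d where cd: "{d, c} \<in> M" "nbrs E v = {c}" "nbrs E d = {c}" using ex[OF v] by blast
  have "nbrs E w = {c}" if w: "w \<in> V" "w \<notin> \<Union>M" for w
  proof -
    obtain c' d' where cd': "{d', c'} \<in> M" "nbrs E w = {c'}" "nbrs E d' = {c'}" using ex[OF w] by blast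
    have "c = c'" by (rule unmatched_same_joint[OF M v w cd cd'])
    then show ?thesis using cd'(2) by simp
  qed
  then show ?thesis using cd by blast
qed

theorem theorem1p1:
  fixes V :: "'a set" and E :: "'a set set" and n :: nat
  assumes "simple_graph V E" and "V \<noteq> {}" and "\<forall>v\<in>V. \<not> isolated E v"
    and "2 \<le> n" and "n \<le> matching_number E"
  shows "scarf_ideal V (squarefree_power V (edge_ideal V E) n :: ('a, 'k::field) mpoly set) \<longleftrightarrow>
    (\<exists>M. perfect_matching V E M \<and> card M = n) \<or>
    (\<exists>(x :: nat \<Rightarrow> 'a) (y :: nat \<Rightarrow> 'a) l. l \<ge> 1 \<and>
       inj_on x {1..2*n} \<and> inj_on y {1..l} \<and> x ` {1..2*n} \<inter> y ` {1..l} = {} \<and>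
       V = x ` {1..2*n} \<union> y ` {1..l} \<and>
       matching E {{x (2*i - 1), x (2*i)} | i. i \<in> {1..n}} \<and>
       (\<forall>v \<in> insert (x (2*n)) (y ` {1..l}). leaf V E v \<and> joint_of E v (x (2*n - 1))))"
    (is "?scarf \<longleftrightarrow> ?perfect \<or> ?joint")
proof
  note sg = assms(1)
  assume scarf: ?scarf
  interpret scarf_matchings V E n
    by (rule scarf_matchings_if_scarf_ideal[OF sg _ scarf]) (use assms(4) in simp)
  have "finite {M. matching E M}"
    by (rule finite_subset[of _ "Pow E"]) (use simple_graph_finite(2)[OF sg] in \<open>auto simp: matching_def\<close>)
  moreover have "matching E {}" by (simp add: matching_def)
  ultimately have "matching_number E \<in> card ` {M. matching E M}"
    unfolding matching_number_def by (intro Max_in) auto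
  then obtain M0 where M0: "matching E M0" "card M0 = matching_number E" by auto
  \<comment> \<open>Any \<open>n\<close> edges of a maximum matching will do as a start; that no
    matching is larger comes out only inside \<open>common_joint\<close>.\<close>
  obtain M where "M \<subseteq> M0" and cM: "card M = n"
    using obtain_subset_with_card_n[of n M0] M0(2) assms(5) by auto
  then have M: "matching E M" using matching_subset[OF M0(1)] by blast
  note MU = matching_card_Union[OF sg M]
  show "?perfect \<or> ?joint"
  proof (cases "\<Union>M = V")
    case True
    then show ?thesis using M cM by (auto simp: perfect_matching_def)
  next
    case False
    have no_isolated: "nbrs E v \<noteq> {}" if "v \<in> V" for v using assms(3) that by (simp add: isolated_def)
    obtain c d where cd: "{d, c} \<in> M" "\<And>v. v \<in> insert d (V - \<Union>M) \<Longrightarrow> nbrs E v = {c}"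
      using common_joint[OF assms(4) no_isolated M cM False] by blast
    obtain x where x: "inj_on x {1..2 * n}" "x ` {1..2 * n} = \<Union>M"
      "{{x (2 * i - 1), x (2 * i)} | i. i \<in> {1..n}} = M" "x (2 * n - 1) = c" "x (2 * n) = d"
      using matching_labelling[OF sg M cM cd(1)] by blast
    define l where "l = card (V - \<Union>M)"
    have fin: "finite (V - \<Union>M)" using simple_graph_finite(1)[OF sg] by simp
    then obtain y where y: "bij_betw y {1..l} (V - \<Union>M)"
      unfolding l_def using ex_bij_betw_nat_finite_1 by blast
    then have y': "inj_on y {1..l}" "y ` {1..l} = V - \<Union>M" by (auto simp: bij_betw_def)
    have "V - \<Union>M \<noteq> {}" using False MU(3) by blast
    then have l: "l \<ge> 1" unfolding l_def using fin by (simp add: Suc_le_eq card_gt_0_iff)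
    have "d \<in> V" using cd(1) MU(3) by blast
    then have "leaf V E v \<and> joint_of E v c" if "v \<in> insert d (V - \<Union>M)" for v
      using that cd(2)[OF that] by (auto simp: leaf_def joint_of_def)
    then have leaves: "\<forall>v\<in>insert (x (2 * n)) (y ` {1..l}). leaf V E v \<and> joint_of E v (x (2 * n - 1))"
      unfolding x(4,5) y'(2) by blast
    have parts: "V = x ` {1..2 * n} \<union> y ` {1..l}" "x ` {1..2 * n} \<inter> y ` {1..l} = {}"
      unfolding x(2) y'(2) using MU(3) by auto
    have "matching E {{x (2 * i - 1), x (2 * i)} | i. i \<in> {1..n}}" unfolding x(3) by (rule M)
    then have ?joint using l x(1) y'(1) parts(2,1) leaves by (intro exI conjI)
    then show ?thesis ..
  qed
next
  note sg = assms(1)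
  assume "?perfect \<or> ?joint"
  then show ?scarf
  proof
    assume ?perfect
    then show ?scarf using scarf_ideal_perfect_matching[OF sg assms(2)] by blast
  next
    assume ?joint
    then obtain x y :: "nat \<Rightarrow> 'a" and l where l: "l \<ge> 1"
      and inj: "inj_on x {1..2*n}" "inj_on y {1..l}" and disj: "x ` {1..2*n} \<inter> y ` {1..l} = {}"
      and V: "V = x ` {1..2*n} \<union> y ` {1..l}"
      and leaf: "\<forall>v \<in> insert (x (2*n)) (y ` {1..l}). leaf V E v \<and> joint_of E v (x (2*n - 1))"
      by (elim exE conjE) (rule that)
    let ?L = "insert (x (2*n)) (y ` {1..l})"
    have xn: "x (2 * n) \<in> x ` {1..2*n}" using assms(4) by auto
    \<comment> \<open>The vertex \<open>x (2*n)\<close> is itself among the leaves, so of the 2n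
      vertices labelled by \<open>x\<close> only 2n - 1 remain outside \<open>?L\<close>.\<close>
    then have "V - ?L = x ` {1..2*n} - {x (2*n)}" using V disj by auto
    then have card: "card (V - ?L) = 2 * n - 1" using xn card_image[OF inj(1)] by simp
    have sub: "?L \<subseteq> V" using V xn by auto
    have "nbrs E v = {x (2*n - 1)}" if "v \<in> ?L" for v
    proof -
      have "card (nbrs E v) = 1" "x (2*n - 1) \<in> nbrs E v" using leaf that by (auto simp: leaf_def joint_of_def)
      then show ?thesis by (metis card_1_singletonE singletonD)
    qed
    then show ?scarf using scarf_ideal_common_joint[OF sg sub card] assms(4) by auto
  qed
qed

end
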